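(* Let $n,d\ge1$ and let $M$ be a $\mathfrak q(n)$-supermodule. Then the map which sends $c_i\mapsto C_i$ ($1\le i\le d$), $s_i\mapsto S_{i,i+1}$ ($1\le i<d$) and $x_i\mapsto X_i$ ($1\le i\le d$) defines a homomorphism of superalgebras $$\mathcal H(d)\longrightarrow\operatorname{End}_{\mathfrak q(n)}(M\otimes V^{\otimes d}).$$
   Context: Everything is over $\mathbb C$ and $\mathbb Z_2$-graded, with the usual sign rule $(a\otimes b)(a'\otimes b')=(-1)^{p(b)p(a')}aa'\otimes bb'$ for products and for actions on tensor products; endomorphisms commuting with $\mathfrak q(n)$ are understood in the super sense. $\mathcal H(d)$ is the degenerate affine Hecke-Clifford algebra: even generators $s_1,\dots,s_{d-1},x_1,\dots,x_d$, odd generators $c_1,\dots,c_d$; as a vector space $\mathbb C[x_1,\dots,x_d]\otimes\mathcal C\ell(d)\otimes\mathbb CS_d$; the $x_i$ commute, the $s_i$ satisfy the Coxeter relations of $S_d$, $c_i^2=-1$, $c_ic_j=-c_jc_i$ ($i\neq j$), $s_ic_i=c_{i+1}s_i$, $s_ic_{i+1}=c_is_i$, $s_ic_j=c_js_i$ ($j\ne i,i+1$), $c_ix_i=-x_ic_i$, $c_jx_i=x_ic_j$ ($j\neq i$), $s_ix_i=x_{i+1}s_i-1+c_ic_{i+1}$, $s_ix_j=x_js_i$ ($j\ne i,i+1$). Let $I=\{-n,\dots,-1,1,\dots,n\}$, $I^+=\{1,\dots,n\}$. $V=\mathbb C^{n|n}$ has basis $\{v_i\}_{i\in I}$ with $v_k$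 even and $v_{-k}$ odd for $k\in I^+$; $E_{ij}$ are the matrix units of $\operatorname{End}(V)$. For $i,j\in I^+$ set $e_{ij}=E_{ij}+E_{-i,-j}$, $f_{ij}=E_{-i,j}+E_{i,-j}$, $\bar e_{ij}=E_{ij}-E_{-i,-j}$, $\bar f_{ij}=E_{-i,j}-E_{i,-j}$. The Lie superalgebra $\mathfrak q(n)\subset\mathfrak{gl}(n|n)$ is the span of the $e_{ij},f_{ij}$ with superbracket $[x,y]=xy-(-1)^{p(x)p(y)}yx$. Let $C=\sum_{i\in I^+}\bar f_{ii}$, $S=\sum_{i,j\in I}\operatorname{sgn}(j)E_{ij}\otimes E_{ji}\in\operatorname{End}(V)^{\otimes2}$ and $\Omega=\sum_{i,j\in I^+}e_{ij}\otimes\bar e_{ji}-\sum_{i,j\in I^+}f_{ij}\otimes\bar f_{ji}$. Number the tensor factors of $M\otimes V^{\otimes d}$ by $0,1,\dots,d$ ($M$ is factor $0$). $C_i$ is $C$ acting in factor $i$; for $1\le i<j\le d$, $S_{ij}$ is $S$ acting in factors $i,j$; for $1\le i\le d$, $\Omega_{0i}$ is $\Omega$ acting with its first leg (elements of $\mathfrak q(n)$) on $M$ and second leg on factor $i$, and identity on other factors. Set $X_i=\Omega_{0i}+\sum_{1\le j<i}(1-C_jC_i)S_{ji}$. *)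

theory Defs
  imports
    Complex_Main
    "HOL-Library.FuncSet"
    "HOL-Library.Poly_Mapping"
    "HOL-Library.Z2"
    "HOL-Algebra.Module"
    "HOL-Algebra.QuotRing"
begin

section \<open>Superalgebras\<close>

text \<open>Parities are elements of the field \<open>bit\<close>, so the Koszul sign \<open>(-1)^(p q)\<close> is
  \<open>ssign (p * q)\<close>.\<close>

definition ssign :: "bit \<Rightarrow> complex" where
  "ssign p = (if p = 0 then 1 else -1)"

definition superalg_hom ::
  "(complex, 'a, 'x) module_scheme \<Rightarrow> (bit \<Rightarrow> 'a set) \<Rightarrow>
   (complex, 'b, 'y) module_scheme \<Rightarrow> (bit \<Rightarrow> 'b set) \<Rightarrow> ('a \<Rightarrow> 'b) \<Rightarrow> bool" where
  "superalg_hom A Agr B Bgr \<phi> \<longleftrightarrow>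
     \<phi> \<in> ring_hom A B \<and>
     (\<forall>c. \<forall>a\<in>carrier A. \<phi> (c \<odot>\<^bsub>A\<^esub> a) = c \<odot>\<^bsub>B\<^esub> \<phi> a) \<and>
     (\<forall>p. \<phi> ` Agr p \<subseteq> Bgr p)"

section \<open>The degenerate affine Hecke-Clifford algebra\<close>

datatype hgen = GenS nat | GenX nat | GenC nat

fun gen_parity :: "hgen \<Rightarrow> bit" where
  "gen_parity (GenS i) = 0"
| "gen_parity (GenX i) = 0"
| "gen_parity (GenC i) = 1"

definition hgens :: "nat \<Rightarrow> hgen set" where
  "hgens d = GenS ` {1..<d} \<union> GenX ` {1..d} \<union> GenC ` {1..d}"

text \<open>Lists are made the free monoid, so that \<open>hgen list \<Rightarrow>\<^sub>0 complex\<close>, with the convolution product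
  of \<open>Poly_Mapping\<close>, is the free associative algebra on \<open>hgen\<close>.\<close>

instantiation list :: (type) monoid_add
begin
definition zero_list :: "'a list" where "zero_list = []"
definition plus_list :: "'a list \<Rightarrow> 'a list \<Rightarrow> 'a list" where "plus_list xs ys = xs @ ys"
instance by standard (simp_all add: zero_list_def plus_list_def)
end

type_synonym free_elem = "hgen list \<Rightarrow>\<^sub>0 complex"

definition free_alg :: "nat \<Rightarrow> (complex, free_elem) module" where
  "free_alg d = \<lparr>carrier = {f. \<forall>w\<in>Poly_Mapping.keys f. set w \<subseteq> hgens d}, mult = (*), one = 1,
     zero = 0, add = (+), smult = (\<lambda>c f. Poly_Mapping.single 0 c * f)\<rparr>"

definition free_gr :: "nat \<Rightarrow> bit \<Rightarrow> free_elem set" where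
  "free_gr d p = {f \<in> carrier (free_alg d). \<forall>w\<in>Poly_Mapping.keys f. sum_list (map gen_parity w) = p}"

definition fs :: "nat \<Rightarrow> free_elem" where "fs i = Poly_Mapping.single [GenS i] 1"
definition fx :: "nat \<Rightarrow> free_elem" where "fx i = Poly_Mapping.single [GenX i] 1"
definition fc :: "nat \<Rightarrow> free_elem" where "fc i = Poly_Mapping.single [GenC i] 1"

text \<open>Each relation \<open>l = r\<close> is recorded as the element \<open>l - r\<close>.\<close>

definition hc_rels :: "nat \<Rightarrow> free_elem set" where
  "hc_rels d =
     {fx i * fx j - fx j * fx i | i j. i \<in> {1..d} \<and> j \<in> {1..d}} \<union>
     {fs i * fs i - 1 | i. i \<in> {1..<d}} \<union>
     {fs i * fs (i+1) * fs i - fs (i+1) * fs i * fs (i+1) | i. i \<in> {1..<d} \<and> i + 1 \<in> {1..<d}} \<union>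
     {fs i * fs j - fs j * fs i | i j. i \<in> {1..<d} \<and> j \<in> {1..<d} \<and> j \<noteq> i \<and> j \<noteq> i + 1 \<and> i \<noteq> j + 1} \<union>
     {fc i * fc i - (- 1) | i. i \<in> {1..d}} \<union>
     {fc i * fc j - (- (fc j * fc i)) | i j. i \<in> {1..d} \<and> j \<in> {1..d} \<and> i \<noteq> j} \<union>
     {fs i * fc i - fc (i+1) * fs i | i. i \<in> {1..<d}} \<union>
     {fs i * fc (i+1) - fc i * fs i | i. i \<in> {1..<d}} \<union>
     {fs i * fc j - fc j * fs i | i j. i \<in> {1..<d} \<and> j \<in> {1..d} \<and> j \<noteq> i \<and> j \<noteq> i + 1} \<union>
     {fc i * fx i - (- (fx i * fc i)) | i. i \<in> {1..d}} \<union>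
     {fc j * fx i - fx i * fc j | i j. i \<in> {1..d} \<and> j \<in> {1..d} \<and> j \<noteq> i} \<union>
     {fs i * fx i - (fx (i+1) * fs i - 1 + fc i * fc (i+1)) | i. i \<in> {1..<d}} \<union>
     {fs i * fx j - fx j * fs i | i j. i \<in> {1..<d} \<and> j \<in> {1..d} \<and> j \<noteq> i \<and> j \<noteq> i + 1}"

definition hc_ideal :: "nat \<Rightarrow> free_elem set" where
  "hc_ideal d = Idl\<^bsub>free_alg d\<^esub> (hc_rels d)"

definition hc_class :: "nat \<Rightarrow> free_elem \<Rightarrow> free_elem set" where
  "hc_class d f = hc_ideal d +>\<^bsub>free_alg d\<^esub> f"

definition hecke_clifford :: "nat \<Rightarrow> (complex, free_elem set) module" where
  "hecke_clifford d = (let Q = free_alg d Quot hc_ideal d in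
     \<lparr>carrier = carrier Q, mult = mult Q, one = one Q, zero = zero Q, add = add Q,
      smult = (\<lambda>c U. hc_class d (Poly_Mapping.single 0 c) \<otimes>\<^bsub>Q\<^esub> U)\<rparr>)"

definition hc_gr :: "nat \<Rightarrow> bit \<Rightarrow> free_elem set set" where
  "hc_gr d p = hc_class d ` free_gr d p"

definition hc_s :: "nat \<Rightarrow> nat \<Rightarrow> free_elem set" where "hc_s d i = hc_class d (fs i)"
definition hc_x :: "nat \<Rightarrow> nat \<Rightarrow> free_elem set" where "hc_x d i = hc_class d (fx i)"
definition hc_c :: "nat \<Rightarrow> nat \<Rightarrow> free_elem set" where "hc_c d i = hc_class d (fc i)"

section \<open>The Lie superalgebra q(n) and its supermodules\<close>

text \<open>An endomorphism of \<open>V\<close> is its matrix \<open>A a b\<close> (row \<open>a\<close>, column \<open>b\<close>), indexed by \<open>idx n\<close> and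
  zero outside it.\<close>

type_synonym mat = "int \<Rightarrow> int \<Rightarrow> complex"

definition idx :: "nat \<Rightarrow> int set" where "idx n = {- int n..int n} - {0}"
definition idx_pos :: "nat \<Rightarrow> int set" where "idx_pos n = {1..int n}"

definition par :: "int \<Rightarrow> bit" where "par a = (if a > 0 then 0 else 1)"

definition E :: "int \<Rightarrow> int \<Rightarrow> mat" where
  "E i j = (\<lambda>a b. if a = i \<and> b = j then 1 else 0)"

definition e_mat :: "int \<Rightarrow> int \<Rightarrow> mat" where
  "e_mat i j = (\<lambda>a b. E i j a b + E (-i) (-j) a b)"
definition f_mat :: "int \<Rightarrow> int \<Rightarrow> mat" where
  "f_mat i j = (\<lambda>a b. E (-i) j a b + E i (-j) a b)"
definition ebar_mat :: "int \<Rightarrow> int \<Rightarrow> mat" where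
  "ebar_mat i j = (\<lambda>a b. E i j a b - E (-i) (-j) a b)"
definition fbar_mat :: "int \<Rightarrow> int \<Rightarrow> mat" where
  "fbar_mat i j = (\<lambda>a b. E (-i) j a b - E i (-j) a b)"

definition C_mat :: "nat \<Rightarrow> mat" where
  "C_mat n = (\<lambda>a b. \<Sum>i\<in>idx_pos n. fbar_mat i i a b)"

definition mat_mult :: "nat \<Rightarrow> mat \<Rightarrow> mat \<Rightarrow> mat" where
  "mat_mult n A B = (\<lambda>a b. \<Sum>k\<in>idx n. A a k * B k b)"

definition q_part :: "nat \<Rightarrow> bit \<Rightarrow> mat set" where
  "q_part n p = {x. \<exists>\<alpha> :: int \<Rightarrow> int \<Rightarrow> complex.
     x = (\<lambda>a b. \<Sum>i\<in>idx_pos n. \<Sum>j\<in>idx_pos n.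
            \<alpha> i j * (if p = 0 then e_mat i j else f_mat i j) a b)}"

definition q_alg :: "nat \<Rightarrow> mat set" where
  "q_alg n = {(\<lambda>a b. x a b + y a b) | x y. x \<in> q_part n 0 \<and> y \<in> q_part n 1}"

text \<open>The superbracket of homogeneous matrices \<open>x\<close> and \<open>y\<close> of parities \<open>r\<close> and \<open>s\<close>.\<close>

definition sbracket :: "nat \<Rightarrow> bit \<Rightarrow> bit \<Rightarrow> mat \<Rightarrow> mat \<Rightarrow> mat" where
  "sbracket n r s x y = (\<lambda>a b. mat_mult n x y a b - ssign (r * s) * mat_mult n y x a b)"

text \<open>The space of the supermodule is the whole type \<open>'m\<close>, with scalar multiplication \<open>sc\<close>,
  homogeneous parts \<open>M 0\<close> and \<open>M 1\<close>, and action \<open>\<rho>\<close>.\<close>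

locale q_supermodule = vector_space sc
  for sc :: "complex \<Rightarrow> 'm::ab_group_add \<Rightarrow> 'm" +
  fixes n :: nat and M :: "bit \<Rightarrow> 'm set" and \<rho> :: "mat \<Rightarrow> 'm \<Rightarrow> 'm"
  assumes subspace_part: "subspace (M p)"
    and parts_disjoint: "M 0 \<inter> M 1 = {0}"
    and parts_span: "\<exists>a\<in>M 0. \<exists>b\<in>M 1. m = a + b"
    and linear_action: "x \<in> q_alg n \<Longrightarrow> Vector_Spaces.linear sc sc (\<rho> x)"
    and action_add: "x \<in> q_alg n \<Longrightarrow> y \<in> q_alg n \<Longrightarrow>
           \<rho> (\<lambda>a b. x a b + y a b) m = \<rho> x m + \<rho> y m"
    and action_scale: "x \<in> q_alg n \<Longrightarrow> \<rho> (\<lambda>a b. c * x a b) m = sc c (\<rho> x m)"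
    and action_parity: "x \<in> q_part n r \<Longrightarrow> m \<in> M p \<Longrightarrow> \<rho> x m \<in> M (r + p)"
    and action_bracket: "x \<in> q_part n r \<Longrightarrow> y \<in> q_part n s \<Longrightarrow>
           \<rho> (sbracket n r s x y) m = \<rho> x (\<rho> y m) - sc (ssign (r * s)) (\<rho> y (\<rho> x m))"

definition component :: "(bit \<Rightarrow> 'm::ab_group_add set) \<Rightarrow> bit \<Rightarrow> 'm \<Rightarrow> 'm" where
  "component M p m = (THE a. a \<in> M p \<and> m - a \<in> M (p + 1))"

section \<open>The tensor product of \<open>M\<close> with the \<open>d\<close>-th tensor power of \<open>V\<close>\<close>

text \<open>As \<open>V\<close> has the finite basis \<open>v a\<close>, \<open>a \<in> idx n\<close>, every tensor is uniquely a sum, over words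
  \<open>w\<close> of length \<open>d\<close> in \<open>idx n\<close>, of terms \<open>t w \<otimes> v (w ! 0) \<otimes> \<dots> \<otimes> v (w ! (d - 1))\<close> with \<open>t w\<close> in
  the module. It is represented by the coefficient function \<open>t\<close>. Factor number \<open>i\<close> (\<open>1 \<le> i \<le> d\<close>)
  is the letter \<open>w ! (i - 1)\<close>.\<close>

type_synonym 'm tensor = "int list \<Rightarrow> 'm"

definition words :: "nat \<Rightarrow> nat \<Rightarrow> int list set" where
  "words n d = {w. length w = d \<and> set w \<subseteq> idx n}"

definition tensors :: "nat \<Rightarrow> nat \<Rightarrow> 'm::ab_group_add tensor set" where
  "tensors n d = {t. \<forall>w. w \<notin> words n d \<longrightarrow> t w = 0}"

definition tensors_gr ::
  "nat \<Rightarrow> nat \<Rightarrow> (bit \<Rightarrow> 'm::ab_group_add set) \<Rightarrow> bit \<Rightarrow> 'm tensor set" where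
  "tensors_gr n d M p =
     {t \<in> tensors n d. \<forall>w\<in>words n d. t w \<in> M (p + sum_list (map par w))}"

definition basis_tensor :: "'m::ab_group_add \<Rightarrow> int list \<Rightarrow> 'm tensor" where
  "basis_tensor m w = (\<lambda>u. if u = w then m else 0)"

text \<open>\<open>factor_op sc M n i A\<close> is \<open>A\<close> acting in factor \<open>i\<close>. A matrix unit \<open>E a b\<close> has parity
  \<open>par a + par b\<close> and picks up the sign of moving it past factors \<open>0, \<dots>, i - 1\<close>; see lemma
  \<open>factor_op_basis_tensor\<close> below.\<close>

definition factor_op ::
  "(complex \<Rightarrow> 'm::ab_group_add \<Rightarrow> 'm) \<Rightarrow> (bit \<Rightarrow> 'm set) \<Rightarrow> nat \<Rightarrow> nat \<Rightarrow> mat \<Rightarrow>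
   'm tensor \<Rightarrow> 'm tensor" where
  "factor_op sc M n i A t = (\<lambda>w. \<Sum>b\<in>idx n. \<Sum>q\<in>{0, 1}.
     sc (ssign ((par (w ! (i - 1)) + par b) * (q + sum_list (map par (take (i - 1) w))))
           * A (w ! (i - 1)) b)
        (component M q (t (w[i - 1 := b]))))"

text \<open>Since factor \<open>0\<close> is leftmost, no sign occurs there.\<close>

definition factor0_op :: "(mat \<Rightarrow> 'm \<Rightarrow> 'm) \<Rightarrow> mat \<Rightarrow> 'm tensor \<Rightarrow> 'm tensor" where
  "factor0_op \<rho> x t = (\<lambda>w. \<rho> x (t w))"

definition tensor_action ::
  "(complex \<Rightarrow> 'm::ab_group_add \<Rightarrow> 'm) \<Rightarrow> nat \<Rightarrow> (bit \<Rightarrow> 'm set) \<Rightarrow> (mat \<Rightarrow> 'm \<Rightarrow> 'm) \<Rightarrow> nat \<Rightarrow>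
   mat \<Rightarrow> 'm tensor \<Rightarrow> 'm tensor" where
  "tensor_action sc n M \<rho> d x t =
     (\<lambda>w. factor0_op \<rho> x t w + (\<Sum>i=1..d. factor_op sc M n i x t w))"

definition C_op ::
  "(complex \<Rightarrow> 'm::ab_group_add \<Rightarrow> 'm) \<Rightarrow> nat \<Rightarrow> (bit \<Rightarrow> 'm set) \<Rightarrow> nat \<Rightarrow> 'm tensor \<Rightarrow> 'm tensor"
  where "C_op sc n M i = factor_op sc M n i (C_mat n)"

text \<open>By the sign rule, \<open>A \<otimes> B\<close> placed in factors \<open>i < j\<close> is the operator \<open>A\<close> in factor \<open>i\<close>
  composed with (after) \<open>B\<close> in factor \<open>j\<close>.\<close>

definition S_op ::
  "(complex \<Rightarrow> 'm::ab_group_add \<Rightarrow> 'm) \<Rightarrow> nat \<Rightarrow> (bit \<Rightarrow> 'm set) \<Rightarrow> nat \<Rightarrow> nat \<Rightarrow>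
   'm tensor \<Rightarrow> 'm tensor" where
  "S_op sc n M i j t = (\<lambda>w. \<Sum>a\<in>idx n. \<Sum>b\<in>idx n.
     sc (complex_of_int (sgn b))
        (factor_op sc M n i (E a b) (factor_op sc M n j (E b a) t) w))"

definition Omega_op ::
  "(complex \<Rightarrow> 'm::ab_group_add \<Rightarrow> 'm) \<Rightarrow> nat \<Rightarrow> (bit \<Rightarrow> 'm set) \<Rightarrow> (mat \<Rightarrow> 'm \<Rightarrow> 'm) \<Rightarrow> nat \<Rightarrow>
   'm tensor \<Rightarrow> 'm tensor" where
  "Omega_op sc n M \<rho> i t = (\<lambda>w.
     (\<Sum>a\<in>idx_pos n. \<Sum>b\<in>idx_pos n.
        factor0_op \<rho> (e_mat a b) (factor_op sc M n i (ebar_mat b a) t) w) -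
     (\<Sum>a\<in>idx_pos n. \<Sum>b\<in>idx_pos n.
        factor0_op \<rho> (f_mat a b) (factor_op sc M n i (fbar_mat b a) t) w))"

definition X_op ::
  "(complex \<Rightarrow> 'm::ab_group_add \<Rightarrow> 'm) \<Rightarrow> nat \<Rightarrow> (bit \<Rightarrow> 'm set) \<Rightarrow> (mat \<Rightarrow> 'm \<Rightarrow> 'm) \<Rightarrow> nat \<Rightarrow>
   'm tensor \<Rightarrow> 'm tensor" where
  "X_op sc n M \<rho> i t = (\<lambda>w. Omega_op sc n M \<rho> i t w +
     (\<Sum>j\<in>{1..<i}. S_op sc n M j i t w - C_op sc n M j (C_op sc n M i (S_op sc n M j i t)) w))"

section \<open>The superalgebra of endomorphisms commuting with q(n)\<close>

text \<open>Endomorphisms of the tensor space are functions that are \<open>extensional\<close> on \<open>tensors n d\<close>.\<close>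

definition q_end_gr ::
  "(complex \<Rightarrow> 'm::ab_group_add \<Rightarrow> 'm) \<Rightarrow> nat \<Rightarrow> (bit \<Rightarrow> 'm set) \<Rightarrow> (mat \<Rightarrow> 'm \<Rightarrow> 'm) \<Rightarrow> nat \<Rightarrow>
   bit \<Rightarrow> ('m tensor \<Rightarrow> 'm tensor) set" where
  "q_end_gr sc n M \<rho> d p = {F \<in> tensors n d \<rightarrow>\<^sub>E tensors n d.
     (\<forall>t\<in>tensors n d. \<forall>u\<in>tensors n d. F (\<lambda>w. t w + u w) = (\<lambda>w. F t w + F u w)) \<and>
     (\<forall>c. \<forall>t\<in>tensors n d. F (\<lambda>w. sc c (t w)) = (\<lambda>w. sc c (F t w))) \<and>
     (\<forall>q. F ` tensors_gr n d M q \<subseteq> tensors_gr n d M (p + q)) \<and>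
     (\<forall>r. \<forall>x\<in>q_part n r. \<forall>t\<in>tensors n d.
        F (tensor_action sc n M \<rho> d x t) =
          (\<lambda>w. sc (ssign (p * r)) (tensor_action sc n M \<rho> d x (F t) w)))}"

definition q_end ::
  "(complex \<Rightarrow> 'm::ab_group_add \<Rightarrow> 'm) \<Rightarrow> nat \<Rightarrow> (bit \<Rightarrow> 'm set) \<Rightarrow> (mat \<Rightarrow> 'm \<Rightarrow> 'm) \<Rightarrow> nat \<Rightarrow>
   (complex, 'm tensor \<Rightarrow> 'm tensor) module" where
  "q_end sc n M \<rho> d =
     \<lparr>carrier = {(\<lambda>t\<in>tensors n d. (\<lambda>w. F t w + G t w)) | F G.
                   F \<in> q_end_gr sc n M \<rho> d 0 \<and> G \<in> q_end_gr sc n M \<rho> d 1},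
      mult = (\<lambda>F G. compose (tensors n d) F G),
      one = (\<lambda>t\<in>tensors n d. t),
      zero = (\<lambda>t\<in>tensors n d. (\<lambda>w. 0)),
      add = (\<lambda>F G. \<lambda>t\<in>tensors n d. (\<lambda>w. F t w + G t w)),
      smult = (\<lambda>c F. \<lambda>t\<in>tensors n d. (\<lambda>w. sc c (F t w)))\<rparr>"

section \<open>Checks\<close>

lemma ring_free_alg: "ring (free_alg d)"
proof (rule ringI)
  show "abelian_group (free_alg d)"
  proof (rule abelian_groupI)
    fix f assume f: "f \<in> carrier (free_alg d)"
    show "\<exists>g\<in>carrier (free_alg d). g \<oplus>\<^bsub>free_alg d\<^esub> f = \<zero>\<^bsub>free_alg d\<^esub>"
      using f by (intro bexI[of _ "- f"]) (auto simp: free_alg_def)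
  next
    fix f g assume "f \<in> carrier (free_alg d)" "g \<in> carrier (free_alg d)"
    then show "f \<oplus>\<^bsub>free_alg d\<^esub> g \<in> carrier (free_alg d)"
      using Poly_Mapping.keys_add[of f g] by (auto simp: free_alg_def)
  qed (auto simp: free_alg_def algebra_simps)
  show "Group.monoid (free_alg d)"
  proof (rule Group.monoidI)
    fix f g assume "f \<in> carrier (free_alg d)" "g \<in> carrier (free_alg d)"
    then show "f \<otimes>\<^bsub>free_alg d\<^esub> g \<in> carrier (free_alg d)"
      using keys_mult[of f g] by (fastforce simp: free_alg_def plus_list_def)
  next
    show "\<one>\<^bsub>free_alg d\<^esub> \<in> carrier (free_alg d)"
      by (simp add: free_alg_def zero_list_def)
  qed (auto simp: free_alg_def algebra_simps)
qed (auto simp: free_alg_def algebra_simps)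

lemma hc_rels_subset: "hc_rels d \<subseteq> carrier (free_alg d)"
proof -
  interpret R: ring "free_alg d" by (rule ring_free_alg)
  have g: "fs i \<in> carrier (free_alg d)" if "i \<in> {1..<d}" for i
    using that by (auto simp: fs_def free_alg_def hgens_def)
  have x: "fx i \<in> carrier (free_alg d)" "fc i \<in> carrier (free_alg d)" if "i \<in> {1..d}" for i
    using that by (auto simp: fx_def fc_def free_alg_def hgens_def)
  have m: "f * h \<in> carrier (free_alg d)"
    if "f \<in> carrier (free_alg d)" "h \<in> carrier (free_alg d)" for f h
    using R.m_closed[OF that] by (simp add: free_alg_def)
  have a: "f + h \<in> carrier (free_alg d)"
    if "f \<in> carrier (free_alg d)" "h \<in> carrier (free_alg d)" for f h
    using R.a_closed[OF that] by (simp add: free_alg_def)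
  have u: "- f \<in> carrier (free_alg d)" if "f \<in> carrier (free_alg d)" for f
    using that by (simp add: free_alg_def)
  have s: "f - h \<in> carrier (free_alg d)"
    if "f \<in> carrier (free_alg d)" "h \<in> carrier (free_alg d)" for f h
    using a[OF that(1) u[OF that(2)]] by simp
  have o: "1 \<in> carrier (free_alg d)"
    using R.one_closed by (simp add: free_alg_def)
  show ?thesis
    unfolding hc_rels_def by (auto intro!: s m a u o g x)
qed

lemma ideal_hc_ideal: "ideal (hc_ideal d) (free_alg d)"
  unfolding hc_ideal_def by (rule ring.genideal_ideal[OF ring_free_alg hc_rels_subset])

context q_supermodule
begin

lemma component_homogeneous:
  assumes "m \<in> M p"
  shows "component M q m = (if q = p then m else 0)"
proof -
  have sub: "a - b \<in> M r" if "a \<in> M r" "b \<in> M r" for a b r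
    using that subspace_part[of r] by (rule subspace_diff[rotated 1])
  have z: "0 \<in> M r" for r using subspace_part[of r] by (rule subspace_0)
  have dis: "a = 0" if "a \<in> M r" "a \<in> M (r + 1)" for a r
    using that parts_disjoint by (cases r) auto
  show ?thesis
  proof (cases "q = p")
    case True
    show ?thesis unfolding component_def
    proof (rule the_equality)
      show "(if q = p then m else 0) \<in> M q \<and> m - (if q = p then m else 0) \<in> M (q + 1)"
        using True assms z by simp
      fix a assume a: "a \<in> M q \<and> m - a \<in> M (q + 1)"
      then have "m - a = 0" using dis[of "m - a" q] sub assms True by blast
      then show "a = (if q = p then m else 0)" using True by simp
    qed
  next
    case False
    then have p: "p = q + 1" by (cases p; cases q) auto
    show ?thesis unfolding component_def
    proof (rule the_equality)
      show "(if q = p then m else 0) \<in> M q \<and> m - (if q = p then m else 0) \<in> M (q + 1)"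
        using False p assms z by simp
      fix a assume a: "a \<in> M q \<and> m - a \<in> M (q + 1)"
      then have "a \<in> M (q + 1)" using sub[of m "q + 1" "m - a"] assms p by simp
      then show "a = (if q = p then m else 0)" using dis[of a q] a False by simp
    qed
  qed
qed

text \<open>For \<open>m\<close> homogeneous of parity \<open>p\<close>:
  \<open>E a b\<close> in factor \<open>i\<close> sends \<open>m \<otimes> \<dots> \<otimes> v b \<otimes> \<dots>\<close> to \<open>\<plusminus> m \<otimes> \<dots> \<otimes> v a \<otimes> \<dots>\<close>.\<close>

lemma factor_op_basis_tensor:
  assumes "m \<in> M p" "w \<in> words n d" "1 \<le> i" "i \<le> d" "a \<in> idx n"
  shows "factor_op sc M n i (E a b) (basis_tensor m w) =
    (if w ! (i - 1) = b
     then basis_tensor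
       (sc (ssign ((par a + par b) * (p + sum_list (map par (take (i - 1) w))))) m) (w[i - 1 := a])
     else basis_tensor 0 w)"
proof
  fix u
  have fin: "finite (idx n)" by (simp add: idx_def)
  have len: "i - 1 < length w" using assms by (auto simp: words_def)
  have wb: "w ! (i - 1) \<in> idx n" using assms len by (auto simp: words_def)
  have comp0: "component M q 0 = 0" for q
    using component_homogeneous[of 0 p q] subspace_0[OF subspace_part] by simp
  have comp: "component M q (basis_tensor m w v) = (if v = w \<and> q = p then m else 0)" for q v
    using component_homogeneous[OF assms(1)] comp0 by (simp add: basis_tensor_def)
  let ?f = "\<lambda>c. sc (ssign ((par (u ! (i - 1)) + par c) * (p + sum_list (map par (take (i - 1) u))))
           * E a b (u ! (i - 1)) c) (if u[i - 1 := c] = w then m else 0)"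
  have two: "(\<Sum>q\<in>{0, 1}. if q = p then g q else 0) = g p" for g :: "bit \<Rightarrow> 'm"
    by (cases p) auto
  have eq: "factor_op sc M n i (E a b) (basis_tensor m w) u = (\<Sum>c\<in>idx n. ?f c)"
    unfolding factor_op_def comp
    by (intro sum.cong[OF refl] trans[OF sum.cong[OF refl] two]) auto
  have zero: "?f c = 0" if "\<not> (u = w[i - 1 := a] \<and> c = b \<and> c = w ! (i - 1))" for c
  proof (rule ccontr)
    assume n0: "?f c \<noteq> 0"
    then have 1: "u[i - 1 := c] = w" by (auto split: if_splits)
    from n0 have 2: "u ! (i - 1) = a" "c = b" by (auto simp: E_def split: if_splits)
    have "length u = length w" using 1 by auto
    then have "w ! (i - 1) = c" using 1 len by auto
    moreover have "u = w[i - 1 := a]" using 1 2 by (metis list_update_id list_update_overwrite)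
    ultimately show False using that 2 by auto
  qed
  show "factor_op sc M n i (E a b) (basis_tensor m w) u = (if w ! (i - 1) = b
     then basis_tensor
       (sc (ssign ((par a + par b) * (p + sum_list (map par (take (i - 1) w))))) m) (w[i - 1 := a])
     else basis_tensor 0 w) u"
  proof (cases "u = w[i - 1 := a] \<and> w ! (i - 1) = b")
    case True
    have u: "u = w[i - 1 := a]" and b: "w ! (i - 1) = b" using True by blast+
    have z: "\<forall>c\<in>idx n - {b}. ?f c = 0" using zero b by blast
    have "{b} \<subseteq> idx n" using b wb by blast
    then have "(\<Sum>c\<in>idx n. ?f c) = (\<Sum>c\<in>{b}. ?f c)"
      by (rule sum.mono_neutral_right[OF fin _ z])
    also have "\<dots> = ?f b" by (rule trans[OF sum.insert]) (simp_all only: sum.empty add_0_right finite.emptyI empty_iff not_False_eq_True)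
    finally have 1: "factor_op sc M n i (E a b) (basis_tensor m w) u = ?f b" using eq by (rule trans[rotated])
    have 2: "u ! (i - 1) = a" unfolding u using len by (rule nth_list_update_eq)
    have 3: "u[i - 1 := b] = w" unfolding u list_update_overwrite b[symmetric] by (rule list_update_id)
    have 4: "take (i - 1) u = take (i - 1) w" unfolding u by (rule take_update_cancel) (rule order_refl)
    have "factor_op sc M n i (E a b) (basis_tensor m w) u =
        sc (ssign ((par a + par b) * (p + sum_list (map par (take (i - 1) w))))) m"
      unfolding 1 unfolding 2 3 4 E_def by (simp only: if_True simp_thms mult_1_right)
    also have "\<dots> = basis_tensor
        (sc (ssign ((par a + par b) * (p + sum_list (map par (take (i - 1) w))))) m) (w[i - 1 := a]) u"
      unfolding basis_tensor_def by (rule if_P[symmetric]) (rule u)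
    finally show ?thesis unfolding if_P[OF b] .
  next
    case False
    then have "\<not> (u = w[i - 1 := a] \<and> c = b \<and> c = w ! (i - 1))" for c by metis
    then have "\<forall>c\<in>idx n. ?f c = 0" using zero by metis
    then have "(\<Sum>c\<in>idx n. ?f c) = 0" by (rule sum.neutral)
    then have L: "factor_op sc M n i (E a b) (basis_tensor m w) u = 0" by (rule trans[OF eq])
    show ?thesis
    proof (cases "w ! (i - 1) = b")
      case True
      then have "u \<noteq> w[i - 1 := a]" using False by blast
      then show ?thesis unfolding L unfolding if_P[OF True] basis_tensor_def by (rule if_not_P[symmetric])
    next
      case nb: False
      show ?thesis unfolding L unfolding if_not_P[OF nb] basis_tensor_def by (rule if_cancel[symmetric])
    qed
  qed
qed

end

end

theory Submission
  imports Defs "HOL-Library.Function_Algebras"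
begin

text \<open>For \<open>a\<close>, \<open>b\<close> in the index set \<open>I\<close> put \<open>q\<^bsub>ab\<^esub> = E\<^bsub>ab\<^esub> + E\<^bsub>-a,-b\<^esub>\<close>. Then \<open>q\<^bsub>-a,-b\<^esub> = q\<^bsub>ab\<^esub>\<close>, and
  these matrices are the basis \<open>e\<^bsub>ij\<^esub>\<close>, \<open>f\<^bsub>ij\<^esub>\<close> of \<open>q(n)\<close>, each listed twice. In this notation the sum
  \<open>\<Omega>\<close> has the same shape as the super flip \<open>S = \<Sum> sgn(b) E\<^bsub>ab\<^esub> \<otimes> E\<^bsub>ba\<^esub>\<close>, namely
  \<open>\<Omega> = \<Sum> sgn(b) q\<^bsub>ab\<^esub> \<otimes> E\<^bsub>ba\<^esub>\<close>, and on \<open>V \<otimes> V\<close> a short computation gives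
  \<open>\<Omega> = (1 - C\<^sub>1 C\<^sub>2) S\<close> (lemma \<open>Omega_on_V\<close>). So if \<open>D\<^sub>k\<close> denotes the action of \<open>q(n)\<close> on
  \<open>M \<otimes> V\<^bsup>\<otimes>k\<^esup>\<close>, the definition of \<open>X\<^sub>i\<close> collapses to
  \<open>X\<^sub>i = \<Sum> sgn(b) D\<^bsub>i-1\<^esub>(q\<^bsub>ab\<^esub>) E\<^bsub>ba\<^esub>\<close> with \<open>E\<^bsub>ba\<^esub>\<close> in factor \<open>i\<close> (lemma \<open>X_eq\<close>): it is a single
  \<open>\<Omega>\<close> between the \<open>q(n)\<close>-module \<open>M \<otimes> V\<^bsup>\<otimes>(i-1)\<^esup>\<close> and its neighbour \<open>V\<close>.

  This explains all relations. An element that supercommutes with \<open>D\<^bsub>i-1\<^esub>\<close> and with factor \<open>i\<close>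
  supercommutes with \<open>X\<^sub>i\<close> (lemma \<open>supercomm_X\<close>). The \<open>C\<^sub>j\<close> are odd endomorphisms of \<open>V\<close> that
  supercommute with \<open>q(n)\<close>, flips are even module maps, and \<open>\<Omega>\<close> is \<open>q(n)\<close>-invariant, so that
  \<open>X\<^sub>j\<close> commutes with every \<open>D\<^sub>k\<close>, \<open>k \<ge> j\<close> (lemmas \<open>D_commutes_X\<close>, \<open>X_supercomm_D\<close>). Hence the
  \<open>X\<^sub>i\<close> commute with each other, with \<open>C\<^sub>j\<close> for \<open>j \<noteq> i\<close> and with the flips of two other neighbours; and with
  \<open>k = d\<close> the same facts say that everything commutes with \<open>q(n)\<close>. The relation between \<open>s\<^sub>i\<close>,
  \<open>x\<^sub>i\<close> and \<open>x\<^bsub>i+1\<^esub>\<close> holds because \<open>D\<^sub>i = D\<^bsub>i-1\<^esub> + q\<close> (\<open>q\<close> in factor \<open>i\<close>): conjugating \<open>X\<^sub>i\<close> by the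
  flip gives the \<open>D\<^bsub>i-1\<^esub>\<close> part of \<open>X\<^bsub>i+1\<^esub>\<close>, and the remaining part is \<open>\<Omega>\<close> on \<open>V \<otimes> V\<close> (lemma
  \<open>S_X\<close>). Finally \<open>C\<^sub>i X\<^sub>i = - X\<^sub>i C\<^sub>i\<close> is the symmetry \<open>(a, b) \<mapsto> (-a, -b)\<close> of the sum.

  These computations use only the signed multiplication rules of matrix units in different
  factors, and are done in an arbitrary ring carrying such elements (locale
  \<open>sergeev_operators\<close>). The actual operators form such a system inside the ring of additive
  endomorphisms of the space of coefficient functions. Evaluating noncommutative polynomials in
  them kills the defining ideal, which gives existence; uniqueness is the fact that
  the generators generate.\<close>

section \<open>Signs and additive endomorphisms\<close>

text \<open>The default rewriting of \<open>+\<close> and \<open>*\<close> on parities to bit operations would destroy the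
  polynomial form in which exponents of signs are compared.\<close>

declare add_bit_eq_xor [simp del] mult_bit_eq_and [simp del]

text \<open>Multiplication by \<open>(-1)^p\<close>. It is defined from the group structure alone, so that one notion
  serves module elements, tensors and operators, and no scalars are needed in the ring of operators.\<close>

definition sg :: "bit \<Rightarrow> 'a::ab_group_add \<Rightarrow> 'a" where
  "sg p x = (if p = 0 then x else - x)"

lemma sg_0 [simp]: "sg 0 x = x" and sg_1 [simp]: "sg 1 x = - x"
  by (simp_all add: sg_def)

lemma sg_sg [simp]: "sg p (sg q x) = sg (p + q) x"
  by (cases p; cases q) (simp_all add: sg_def)

lemma sg_zero [simp]: "sg p 0 = 0"
  by (simp add: sg_def)

lemma sg_add: "sg p (x + y) = sg p x + sg p y"
  by (simp add: sg_def)

lemma sg_diff: "sg p (x - y) = sg p x - sg p y"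
  by (simp add: sg_def)

lemma sg_uminus: "sg p (- x) = - sg p x"
  by (simp add: sg_def)

lemma sg_plus_one: "sg (p + 1) x = - sg p x" "sg (1 + p) x = - sg p x"
  by (cases p; simp add: sg_def)+

lemma sg_sum: "sg p (sum f A) = (\<Sum>x\<in>A. sg p (f x))"
  by (simp add: sg_def sum_negf)

lemma sg_mult_left [simp]: "sg p x * y = sg p (x * y)" for x y :: "'a::ring"
  by (simp add: sg_def)

lemma sg_mult_right [simp]: "x * sg p y = sg p (x * y)" for x y :: "'a::ring"
  by (simp add: sg_def)

lemma bit_double [simp]: "p + p = 0" "p + (p + q) = q" for p q :: bit
  by (cases p; cases q; simp)+

text \<open>Operators are made a type, so that the algebra of operators takes place in a ring type. Complex
  linearity is not built in, since the scalar multiplication of the module is a parameter rather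
  than part of its type; it is added where needed (\<open>lin_op\<close> below). The unit is
  that of a monoid, without \<open>0 \<noteq> 1\<close>, because the trivial group has a single endomorphism.\<close>

typedef (overloaded) 'a add_endo = "{f :: 'a::ab_group_add \<Rightarrow> 'a. \<forall>x y. f (x + y) = f x + f y}"
  morphisms apply_endo Add_endo
  by (rule exI[of _ "\<lambda>x. x"]) simp

setup_lifting type_definition_add_endo

instantiation add_endo :: (ab_group_add) "{ring, monoid_mult}"
begin
lift_definition zero_add_endo :: "'a add_endo" is "\<lambda>x. 0" by simp
lift_definition one_add_endo :: "'a add_endo" is "\<lambda>x. x" by simp
lift_definition plus_add_endo :: "'a add_endo \<Rightarrow> 'a add_endo \<Rightarrow> 'a add_endo" is "\<lambda>f g x. f x + g x"
  by (simp add: algebra_simps)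
lift_definition minus_add_endo :: "'a add_endo \<Rightarrow> 'a add_endo \<Rightarrow> 'a add_endo" is "\<lambda>f g x. f x - g x"
  by (simp add: algebra_simps)
lift_definition uminus_add_endo :: "'a add_endo \<Rightarrow> 'a add_endo" is "\<lambda>f x. - f x"
  by simp
lift_definition times_add_endo :: "'a add_endo \<Rightarrow> 'a add_endo \<Rightarrow> 'a add_endo" is "\<lambda>f g x. f (g x)"
  by simp
instance
  by standard (transfer; simp add: algebra_simps)+
end

lemma apply_endo_add [simp]: "apply_endo T (x + y) = apply_endo T x + apply_endo T y"
  by transfer simp

lemma apply_endo_zero [simp]: "apply_endo T 0 = 0"
  using apply_endo_add[of T 0 0] by simp

lemma apply_endo_uminus [simp]: "apply_endo T (- x) = - apply_endo T x"
  using apply_endo_add[of T x "- x"] by (simp add: eq_neg_iff_add_eq_0 add.commute)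

lemma apply_endo_diff: "apply_endo T (x - y) = apply_endo T x - apply_endo T y"
  using apply_endo_add[of T x "- y"] by simp

lemma apply_endo_arith [simp]:
  "apply_endo 0 x = 0" "apply_endo 1 x = x" "apply_endo (S + T) x = apply_endo S x + apply_endo T x"
  "apply_endo (S - T) x = apply_endo S x - apply_endo T x" "apply_endo (- S) x = - apply_endo S x"
  "apply_endo (S * T) x = apply_endo S (apply_endo T x)"
  by (transfer; simp)+

lemma apply_endo_sum: "apply_endo (sum f A) x = (\<Sum>a\<in>A. apply_endo (f a) x)"
  by (induction A rule: infinite_finite_induct) simp_all

lemma apply_endo_sg: "apply_endo (sg p T) x = sg p (apply_endo T x)" "apply_endo T (sg p x) = sg p (apply_endo T x)"
  by (simp_all add: sg_def)

lemma add_endo_eqI: "(\<And>x. apply_endo S x = apply_endo T x) \<Longrightarrow> S = T"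
  by transfer auto

section \<open>Supercommutation and the bracket relations of q(n)\<close>

lemma finite_idx [simp]: "finite (idx n)"
  by (simp add: idx_def)

lemma uminus_idx [simp]: "- a \<in> idx n \<longleftrightarrow> a \<in> idx n"
  by (auto simp: idx_def)

lemma par_uminus: "a \<in> idx n \<Longrightarrow> par (- a) = par a + 1"
  by (auto simp: idx_def par_def)

lemma par_add_uminus:
  assumes "a \<in> idx n" "b \<in> idx n" shows "par (- a) + par (- b) = par a + par b"
  using assms by (cases "par a"; cases "par b"; simp add: par_uminus)

lemma sum_idx_uminus: "(\<Sum>a\<in>idx n. f (- a)) = (\<Sum>a\<in>idx n. f a)"
  by (rule sum.reindex_bij_witness[of _ uminus uminus]) auto

definition supercomm :: "bit \<Rightarrow> 'r::ring \<Rightarrow> bit \<Rightarrow> 'r \<Rightarrow> bool" where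
  "supercomm p x q y \<longleftrightarrow> x * y = sg (p * q) (y * x)"

lemma supercommD: "supercomm p x q y \<Longrightarrow> x * y = sg (p * q) (y * x)"
  by (simp add: supercomm_def)

lemma supercomm_sym: "supercomm p x q y \<Longrightarrow> supercomm q y p x"
  by (simp add: supercomm_def mult.commute)

lemma supercomm_zero [simp]: "supercomm p 0 q y" "supercomm p x q 0"
  by (simp_all add: supercomm_def)

lemma supercomm_add: "supercomm p x q y \<Longrightarrow> supercomm p x q z \<Longrightarrow> supercomm p x q (y + z)"
  by (simp add: supercomm_def algebra_simps sg_add)

lemma supercomm_sum: "(\<And>a. a \<in> A \<Longrightarrow> supercomm p x q (f a)) \<Longrightarrow> supercomm p x q (sum f A)"
  by (induction A rule: infinite_finite_induct) (simp_all add: supercomm_add)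

lemma supercomm_sg: "supercomm p x q y \<Longrightarrow> supercomm p x q (sg r y)"
  by (simp add: supercomm_def add.commute)

lemma supercomm_mult:
  assumes "supercomm p x q y" "supercomm p x r z" shows "supercomm p x (q + r) (y * z)"
proof -
  have "x * (y * z) = sg (p * q) (y * (x * z))"
    using assms(1) by (simp add: supercomm_def flip: mult.assoc)
  also have "\<dots> = sg (p * (q + r)) (y * z * x)"
    using assms(2) by (simp add: supercomm_def mult.assoc algebra_simps)
  finally show ?thesis by (simp add: supercomm_def)
qed

text \<open>Both factors have the same parity: this is the shape of each term of \<open>S\<close> and \<open>\<Omega>\<close>, which makes
  them even.\<close>

lemma supercomm_mult_even:
  assumes "supercomm p x q y" "supercomm p x q z" shows "supercomm p x 0 (y * z)"
  using supercomm_mult[OF assms] by simp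

text \<open>Membership in the index set is part of the condition, so that the product rule
  \<open>E\<^bsub>ab\<^esub> E\<^bsub>ce\<^esub> = \<delta>\<^bsub>bc\<^esub> E\<^bsub>ae\<^esub>\<close> holds for all integers when \<open>E\<^bsub>ab\<^esub>\<close> is read as zero outside the index set.\<close>

definition delta :: "nat \<Rightarrow> int \<Rightarrow> int \<Rightarrow> 'r::zero \<Rightarrow> 'r" where
  "delta n a b x = (if a = b \<and> a \<in> idx n then x else 0)"

lemma delta_zero [simp]: "delta n a b 0 = 0"
  by (simp add: delta_def)

lemma delta_mult [simp]: "delta n a b x * y = delta n a b (x * y)" "y * delta n a b x = delta n a b (y * x)"
  for x y :: "'r::ring"
  by (auto simp: delta_def)

lemma delta_sg: "sg p (delta n a b x) = delta n a b (sg p x)"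
  by (auto simp: delta_def)

lemma delta_add: "delta n a b (x + y) = delta n a b x + delta n a b y" for x y :: "'r::ab_group_add"
  by (auto simp: delta_def)

lemma sum_delta:
  "(\<Sum>a\<in>idx n. delta n a b (f a)) = (if b \<in> idx n then f b else 0)"
  "(\<Sum>a\<in>idx n. delta n b a (f a)) = (if b \<in> idx n then f b else 0)"
  "(\<Sum>a\<in>idx n. delta n b (- a) (f a)) = (if b \<in> idx n then f (- b) else 0)"
  "(\<Sum>a\<in>idx n. delta n a (- b) (f a)) = (if b \<in> idx n then f (- b) else 0)"
proof -
  show "(\<Sum>a\<in>idx n. delta n a b (f a)) = (if b \<in> idx n then f b else 0)"
    by (simp add: delta_def if_distrib cong: if_cong conj_cong)
  show 2: "(\<Sum>a\<in>idx n. delta n b a (f a)) = (if b \<in> idx n then f b else 0)" for f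
  proof -
    have "(\<Sum>a\<in>idx n. delta n b a (f a)) = (\<Sum>a\<in>idx n. if a = b then f a else 0)"
      by (rule sum.cong) (auto simp: delta_def)
    then show ?thesis by simp
  qed
  show "(\<Sum>a\<in>idx n. delta n b (- a) (f a)) = (if b \<in> idx n then f (- b) else 0)"
    using 2[of "\<lambda>a. f (- a)"] sum_idx_uminus[of "\<lambda>a. delta n b a (f (- a))" n] by simp
  have "(\<Sum>a\<in>idx n. delta n a (- b) (f a)) = (\<Sum>a\<in>idx n. if a = - b then f a else 0)"
    by (rule sum.cong) (auto simp: delta_def)
  then show "(\<Sum>a\<in>idx n. delta n a (- b) (f a)) = (if b \<in> idx n then f (- b) else 0)"
    by simp
qed

lemma delta_sum: "(\<Sum>x\<in>A. delta n a b (f x)) = delta n a b (sum f A)"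
proof (cases "a = b \<and> a \<in> idx n")
  case True
  show ?thesis unfolding delta_def if_P[OF True] ..
next
  case False
  show ?thesis unfolding delta_def if_not_P[OF False] by simp
qed

text \<open>Images of the \<open>q\<^bsub>ab\<^esub> = E\<^bsub>ab\<^esub> + E\<^bsub>-a,-b\<^esub>\<close> under a representation of \<open>q(n)\<close>: the last clause is the
  superbracket that follows from \<open>q\<^bsub>ab\<^esub> q\<^bsub>ce\<^esub> = \<delta>\<^bsub>bc\<^esub> q\<^bsub>ae\<^esub> + \<delta>\<^bsub>b,-c\<^esub> q\<^bsub>a,-e\<^esub>\<close>.\<close>

definition q_family :: "nat \<Rightarrow> (int \<Rightarrow> int \<Rightarrow> 'r::ring) \<Rightarrow> bool" where
  "q_family n D \<longleftrightarrow>
     (\<forall>a b. D (- a) (- b) = D a b) \<and>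
     (\<forall>a b. a \<notin> idx n \<or> b \<notin> idx n \<longrightarrow> D a b = 0) \<and>
     (\<forall>a b c e. D a b * D c e - sg ((par a + par b) * (par c + par e)) (D c e * D a b) =
        delta n b c (D a e) + delta n b (- c) (D a (- e))
        - sg ((par a + par b) * (par c + par e)) (delta n e a (D c b) + delta n e (- a) (D c (- b))))"

text \<open>The tensor product of two representations: the cross terms of the bracket cancel.\<close>

lemma q_family_add:
  assumes D: "q_family n D" and B: "q_family n B"
    and com: "\<And>a b c e. supercomm (par a + par b) (D a b) (par c + par e) (B c e)"
  shows "q_family n (\<lambda>a b. D a b + B a b)"
  unfolding q_family_def
proof (intro conjI allI impI)
  fix a b c e
  show "D (- a) (- b) + B (- a) (- b) = D a b + B a b"
    using D B by (simp add: q_family_def)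
  show "D a b + B a b = 0" if "a \<notin> idx n \<or> b \<notin> idx n"
    using D B that by (auto simp: q_family_def)
  \<comment> \<open>An opaque exponent keeps the simplifier from distributing the sign over the four parities.\<close>
  define s where "s = (par a + par b) * (par c + par e)"
  have 1: "D a b * D c e - sg s (D c e * D a b) = delta n b c (D a e) + delta n b (- c) (D a (- e))
      - sg s (delta n e a (D c b) + delta n e (- a) (D c (- b)))"
    using D by (simp add: q_family_def s_def)
  have 2: "B a b * B c e - sg s (B c e * B a b) = delta n b c (B a e) + delta n b (- c) (B a (- e))
      - sg s (delta n e a (B c b) + delta n e (- a) (B c (- b)))"
    using B by (simp add: q_family_def s_def)
  have 3: "D a b * B c e = sg s (B c e * D a b)"
    using com by (simp add: supercomm_def s_def)
  have "D c e * B a b = sg s (B a b * D c e)"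
    unfolding s_def by (subst supercommD[OF com[of c e a b]]) (simp only: mult.commute)
  then have 4: "sg s (D c e * B a b) = B a b * D c e"
    by simp
  have "(D a b + B a b) * (D c e + B c e) - sg s ((D c e + B c e) * (D a b + B a b)) =
      (D a b * D c e - sg s (D c e * D a b)) + (B a b * B c e - sg s (B c e * B a b))"
    by (simp add: distrib_left distrib_right sg_add 3 4)
  also have "\<dots> = delta n b c (D a e + B a e) + delta n b (- c) (D a (- e) + B a (- e))
      - sg s (delta n e a (D c b + B c b) + delta n e (- a) (D c (- b) + B c (- b)))"
    unfolding 1 2 by (simp add: delta_add sg_add)
  finally show "(D a b + B a b) * (D c e + B c e)
      - sg ((par a + par b) * (par c + par e)) ((D c e + B c e) * (D a b + B a b)) =
      delta n b c (D a e + B a e) + delta n b (- c) (D a (- e) + B a (- e))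
      - sg ((par a + par b) * (par c + par e))
          (delta n e a (D c b + B c b) + delta n e (- a) (D c (- b) + B c (- b)))"
    unfolding s_def .
qed

section \<open>Flips and the action of q(n) on tensor powers\<close>

text \<open>\<open>F i a b\<close> stands for the matrix unit \<open>E\<^bsub>ab\<^esub>\<close> in factor \<open>i\<close> and \<open>g a b\<close> for \<open>q\<^bsub>ab\<^esub>\<close> acting in factor
  \<open>0\<close>. The identity of the tensor space is a separate element \<open>P\<close>, because the ambient ring also
  contains operators on coefficient functions that are supported on other words; there \<open>P\<close> is the
  projection to the tensors.\<close>

locale sergeev_operators =
  fixes n d :: nat and P :: "'r::ring" and F :: "nat \<Rightarrow> int \<Rightarrow> int \<Rightarrow> 'r" and g :: "int \<Rightarrow> int \<Rightarrow> 'r"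
  assumes F_outside: "a \<notin> idx n \<or> b \<notin> idx n \<Longrightarrow> F i a b = 0"
    and F_mult: "F i a b * F i c e = delta n b c (F i a e)"
    and F_unit: "i \<in> {1..d} \<Longrightarrow> (\<Sum>a\<in>idx n. F i a a) = P"
    and F_supercomm: "i \<noteq> j \<Longrightarrow> supercomm (par a + par b) (F i a b) (par c + par e) (F j c e)"
    and g_family: "q_family n g"
    and g_supercomm: "supercomm (par a + par b) (g a b) (par c + par e) (F i c e)"
begin

text \<open>\<open>Q i\<close> is the action of \<open>q(n)\<close> in factor \<open>i\<close>, and \<open>D k\<close> is the action on factors \<open>0\<close> to \<open>k\<close>.\<close>

definition Q :: "nat \<Rightarrow> int \<Rightarrow> int \<Rightarrow> 'r" where
  "Q i a b = F i a b + F i (- a) (- b)"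

definition D :: "nat \<Rightarrow> int \<Rightarrow> int \<Rightarrow> 'r" where
  "D k a b = g a b + (\<Sum>i=1..k. Q i a b)"

text \<open>Here \<open>C\<close> is summed over all indices instead of the positive ones, \<open>sgn(b)\<close> is written as
  \<open>(-1)^(par b)\<close>, and \<open>X\<close> is in its collapsed form. Lemmas \<open>C_op_eq\<close>, \<open>S_op_eq\<close> and \<open>X_op_eq\<close> identify
  these elements with the operators of the theorem.\<close>

definition C :: "nat \<Rightarrow> 'r" where
  "C i = (\<Sum>a\<in>idx n. sg (par a) (F i (- a) a))"

definition S :: "nat \<Rightarrow> nat \<Rightarrow> 'r" where
  "S i j = (\<Sum>a\<in>idx n. \<Sum>b\<in>idx n. sg (par b) (F i a b * F j b a))"

definition X :: "nat \<Rightarrow> 'r" where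
  "X i = (\<Sum>a\<in>idx n. \<Sum>b\<in>idx n. sg (par b) (D (i - 1) a b * F i b a))"

lemma F_supercomm':
  assumes "i \<noteq> j" "p = par a + par b" "q = par c + par e"
  shows "supercomm p (F i a b) q (F j c e)"
  using F_supercomm assms by simp

lemma F_mult_assoc: "F i a b * (F i c e * x) = delta n b c (F i a e * x)"
  by (simp flip: mult.assoc add: F_mult)

lemma P_F: "P * F i a b = F i a b" "F i a b * P = F i a b" if "i \<in> {1..d}"
  using F_outside[of a b i]
  by (auto simp flip: F_unit[OF that] simp: sum_distrib_left sum_distrib_right F_mult sum_delta)

lemma P_P: "i \<in> {1..d} \<Longrightarrow> P * P = P"
  by (subst (2 3) F_unit[symmetric, of i]) (simp_all add: sum_distrib_left P_F)

lemma Q_outside: "a \<notin> idx n \<or> b \<notin> idx n \<Longrightarrow> Q i a b = 0"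
  using F_outside uminus_idx unfolding Q_def by (metis add_0)

lemma supercomm_Q:
  assumes "\<And>a b. supercomm p x (par a + par b) (F i a b)"
  shows "supercomm p x (par a + par b) (Q i a b)"
proof (cases "a \<in> idx n \<and> b \<in> idx n")
  case True
  then have "par (- a) + par (- b) = par a + par b"
    by (simp add: par_add_uminus[where n = n])
  then show ?thesis
    unfolding Q_def by (intro supercomm_add) (use assms[of a b] assms[of "- a" "- b"] in simp_all)
next
  case False
  then show ?thesis by (simp add: Q_outside)
qed

lemma Q_supercomm_F: "i \<noteq> j \<Longrightarrow> supercomm (par a + par b) (Q i a b) (par c + par e) (F j c e)"
  using supercomm_sym supercomm_Q F_supercomm by metis

lemma supercomm_D:
  assumes "\<And>a b. supercomm p x (par a + par b) (g a b)"
    and "\<And>i a b. i \<in> {1..k} \<Longrightarrow> supercomm p x (par a + par b) (Q i a b)"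
  shows "supercomm p x (par a + par b) (D k a b)"
  unfolding D_def using assms by (intro supercomm_add supercomm_sum) auto

lemma D_supercomm_F: "k < i \<Longrightarrow> supercomm (par a + par b) (D k a b) (par c + par e) (F i c e)"
  by (rule supercomm_sym, rule supercomm_D; rule supercomm_sym) (auto intro: g_supercomm Q_supercomm_F)

lemma Q_family: "q_family n (Q i)"
  unfolding q_family_def
proof (intro conjI allI impI)
  fix a b c e
  show "Q i (- a) (- b) = Q i a b" by (simp add: Q_def add.commute)
  show "Q i a b = 0" if "a \<notin> idx n \<or> b \<notin> idx n"
    using that by (rule Q_outside)
  have *: "Q i a b * Q i c e = delta n b c (Q i a e) + delta n b (- c) (Q i a (- e))" for a b c e
    by (auto simp: Q_def distrib_left distrib_right F_mult delta_def algebra_simps)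
  show "Q i a b * Q i c e - sg ((par a + par b) * (par c + par e)) (Q i c e * Q i a b) =
      delta n b c (Q i a e) + delta n b (- c) (Q i a (- e))
      - sg ((par a + par b) * (par c + par e)) (delta n e a (Q i c b) + delta n e (- a) (Q i c (- b)))"
    unfolding * by simp
qed

lemma D_Suc: "D (Suc k) a b = D k a b + Q (Suc k) a b"
  by (simp add: D_def add.assoc)

lemma D_family: "q_family n (D k)"
proof (induction k)
  case 0
  then show ?case using g_family by (simp add: D_def)
next
  case (Suc k)
  have "q_family n (\<lambda>a b. D k a b + Q (Suc k) a b)"
    by (rule q_family_add[OF Suc Q_family]) (auto intro: supercomm_Q D_supercomm_F)
  then show ?case by (simp add: D_Suc[abs_def])
qed

text \<open>\<open>S\<close> is the super flip, characterised here by conjugation: it carries factor \<open>i\<close> to factor \<open>j\<close>.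
  On both sides one summation index is forced, and the two signs agree by the parity identity
  below.\<close>

lemma S_F_left:
  assumes "i \<noteq> j" shows "S i j * F i c e = F j c e * S i j"
proof (cases "c \<in> idx n \<and> e \<in> idx n")
  case True
  have 1: "F i a b * F j b a * F i c e = delta n b c (sg ((par b + par a) * (par c + par e)) (F i a e * F j b a))"
    for a b
    using supercommD[OF F_supercomm[of j i b a c e]] assms
    by (simp add: mult.assoc F_mult_assoc delta_sg)
  have 2: "F j c e * (F i a b * F j b a) = delta n e b (sg ((par c + par e) * (par a + par b)) (F i a b * F j c a))"
    for a b
  proof -
    have "F j c e * (F i a b * F j b a) = sg ((par c + par e) * (par a + par b)) (F i a b * (F j c e * F j b a))"
      using supercommD[OF F_supercomm[of j i c e a b]] assms
      by (simp flip: mult.assoc)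
    then show ?thesis by (simp add: F_mult delta_sg)
  qed
  have bit: "p + (p + q) * (p + r) = r + (p + r) * (q + r)" for p q r :: bit
    by (cases p; cases q; cases r; simp)
  have "S i j * F i c e = (\<Sum>a\<in>idx n. \<Sum>b\<in>idx n. 
      delta n b c (sg (par b + (par b + par a) * (par c + par e)) (F i a e * F j b a)))"
    by (simp add: S_def sum_distrib_right 1 delta_sg)
  also have "\<dots> = (\<Sum>a\<in>idx n. sg (par c + (par c + par a) * (par c + par e)) (F i a e * F j c a))"
    using True by (simp add: sum_delta)
  also have "\<dots> = (\<Sum>a\<in>idx n. sg (par e + (par c + par e) * (par a + par e)) (F i a e * F j c a))"
    by (intro sum.cong refl) (subst bit, rule refl)
  also have "\<dots> = (\<Sum>a\<in>idx n. \<Sum>b\<in>idx n. 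
      delta n e b (sg (par b + (par c + par e) * (par a + par b)) (F i a b * F j c a)))"
    using True by (simp add: sum_delta)
  also have "\<dots> = F j c e * S i j"
    by (simp add: S_def sum_distrib_left 2 delta_sg)
  finally show ?thesis .
next
  case False
  then have "F i c e = 0" "F j c e = 0" using F_outside by blast+
  then show ?thesis by simp
qed

lemma S_sym:
  assumes "i \<noteq> j" shows "S i j = S j i"
proof -
  have "S i j = (\<Sum>a\<in>idx n. \<Sum>b\<in>idx n. sg (par a) (F j b a * F i a b))"
    unfolding S_def
  proof (intro sum.cong refl)
    fix a b
    have bit: "q + (p + q) * (q + p) = p" for p q :: bit by (cases p; cases q; simp)
    show "sg (par b) (F i a b * F j b a) = sg (par a) (F j b a * F i a b)"
      using supercommD[OF F_supercomm[OF assms, of a b b a]] by (simp add: bit)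
  qed
  also have "\<dots> = S j i" unfolding S_def by (rule sum.swap)
  finally show ?thesis .
qed

lemma S_F_right:
  assumes "i \<noteq> j" shows "S i j * F j c e = F i c e * S i j"
  using S_F_left[of j i c e] S_sym[OF assms] assms by simp

lemma S_supercomm_F:
  assumes "k \<noteq> i" "k \<noteq> j" shows "supercomm 0 (S i j) (par a + par b) (F k a b)"
proof (rule supercomm_sym)
  show "supercomm (par a + par b) (F k a b) 0 (S i j)"
    unfolding S_def using assms
    by (intro supercomm_sum supercomm_sg supercomm_mult_even F_supercomm') (auto simp: add.commute)
qed

text \<open>A product of two terms vanishes unless they are opposite, and then the signs combine to
  \<open>sgn(a) sgn(b) (-1)^(par a + par b) = 1\<close>; what remains is the product of two resolutions of
  the identity.\<close>

lemma S_square: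
  assumes "i \<noteq> j" "i \<in> {1..d}" "j \<in> {1..d}" shows "S i j * S i j = P"
proof -
  have 2: "F i a b * F j b a * (F i c e * F j e c) =
      delta n a e (delta n b c (sg (par a + par b) (F i a a * F j b b)))" for a b c e
  proof -
    have "F i a b * F j b a * (F i c e * F j e c) = F i a b * (F j b a * F i c e) * F j e c"
      by (simp add: mult.assoc)
    also have "\<dots> = sg ((par b + par a) * (par c + par e)) (F i a b * F i c e * (F j b a * F j e c))"
      using supercommD[OF F_supercomm[of j i b a c e]] assms by (simp add: mult.assoc)
    also have "\<dots> = delta n a e (delta n b c (sg (par a + par b) (F i a a * F j b b)))"
    proof -
      have bit: "(p + q) * (p + q) = p + q" for p q :: bit by (cases p; cases q; simp)
      show ?thesis by (auto simp: F_mult delta_def bit add.commute)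
    qed
    finally show ?thesis .
  qed
  have "F i a b * F j b a * S i j = (\<Sum>c\<in>idx n. \<Sum>e\<in>idx n.
      sg (par e) (F i a b * F j b a * (F i c e * F j e c)))" for a b
    by (simp add: S_def sum_distrib_left)
  then have "S i j * S i j = (\<Sum>a\<in>idx n. \<Sum>b\<in>idx n. \<Sum>c\<in>idx n. \<Sum>e\<in>idx n.
      sg (par b + par e) (F i a b * F j b a * (F i c e * F j e c)))"
    by (subst (1) S_def) (simp add: sum_distrib_right sg_sum)
  also have "\<dots> = (\<Sum>a\<in>idx n. \<Sum>b\<in>idx n. F i a a * F j b b)"
    by (simp add: 2 delta_sg sum_delta add.assoc)
  also have "\<dots> = P * P"
    by (simp only: sum_product[symmetric] F_unit[OF assms(2)] F_unit[OF assms(3)])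
  also have "\<dots> = P"
    by (rule P_P[OF assms(2)])
  finally show ?thesis .
qed

end

section \<open>The Hecke-Clifford relations\<close>

context sergeev_operators
begin

lemma C_F_left: "C i * F i a b = sg (par a) (F i (- a) b)"
proof -
  have "C i * F i a b = (\<Sum>c\<in>idx n. delta n c a (sg (par c) (F i (- c) b)))"
    by (simp add: C_def sum_distrib_right F_mult delta_sg)
  then show ?thesis using F_outside[of "- a" b i] by (simp add: sum_delta)
qed

lemma C_F_right: "F i a b * C i = - sg (par b) (F i a (- b))"
proof -
  have "F i a b * C i = (\<Sum>c\<in>idx n. delta n b (- c) (sg (par c) (F i a c)))"
    by (simp add: C_def sum_distrib_left F_mult delta_sg)
  then show ?thesis using F_outside[of a "- b" i]
    by (simp add: sum_delta par_uminus[where n = n] sg_plus_one)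
qed

lemma supercomm_C:
  assumes "\<And>a b. supercomm p x (par a + par b) (F i a b)"
  shows "supercomm p x 1 (C i)"
  unfolding C_def
proof (intro supercomm_sum supercomm_sg)
  fix a assume "a \<in> idx n"
  then show "supercomm p x 1 (F i (- a) a)"
    using assms[of "- a" a] by (simp add: par_uminus add.commute[of _ 1] add.assoc)
qed

lemma supercomm_S:
  assumes "\<And>a b. supercomm p x (par a + par b) (F i a b)" "\<And>a b. supercomm p x (par a + par b) (F j a b)"
  shows "supercomm p x 0 (S i j)"
  unfolding S_def
proof (intro supercomm_sum supercomm_sg supercomm_mult_even)
  fix a b
  show "supercomm p x (par a + par b) (F i a b)" by (rule assms)
  show "supercomm p x (par a + par b) (F j b a)" using assms(2)[of b a] by (simp add: add.commute)
qed

text \<open>The common source of the homogeneous relations between \<open>X i\<close> and the other operators.\<close>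

lemma supercomm_X:
  assumes "\<And>a b. supercomm p x (par a + par b) (D (i - 1) a b)" "\<And>a b. supercomm p x (par a + par b) (F i a b)"
  shows "supercomm p x 0 (X i)"
  unfolding X_def
proof (intro supercomm_sum supercomm_sg supercomm_mult_even)
  fix a b
  show "supercomm p x (par a + par b) (D (i - 1) a b)" by (rule assms)
  show "supercomm p x (par a + par b) (F i b a)" using assms(2)[of b a] by (simp add: add.commute)
qed

lemma C_supercomm_F: "i \<noteq> j \<Longrightarrow> supercomm 1 (C i) (par a + par b) (F j a b)"
  by (rule supercomm_sym, rule supercomm_C, rule F_supercomm) simp

lemma C_supercomm_C: "i \<noteq> j \<Longrightarrow> supercomm 1 (C i) 1 (C j)"
  by (rule supercomm_C, rule C_supercomm_F)

lemma C_square: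
  assumes "i \<in> {1..d}" shows "C i * C i = - P"
proof -
  have "C i * C i = (\<Sum>a\<in>idx n. sg (par a) (C i * F i (- a) a))"
    by (subst (2) C_def) (simp add: sum_distrib_left)
  also have "\<dots> = (\<Sum>a\<in>idx n. - F i a a)"
    by (intro sum.cong refl) (simp add: C_F_left par_uminus sg_plus_one sg_uminus)
  finally show ?thesis by (simp add: sum_negf F_unit[OF assms])
qed

lemma C_P: "i \<in> {1..d} \<Longrightarrow> C i * P = C i"
  by (simp add: C_def sum_distrib_right P_F)

text \<open>This is the defining property of the span of the \<open>q\<^bsub>ab\<^esub>\<close>: \<open>q(n)\<close> is the supercentraliser of \<open>C\<close> in \<open>gl(n|n)\<close>.\<close>

lemma C_supercomm_Q: "supercomm 1 (C i) (par a + par b) (Q j a b)"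
proof (cases "i = j")
  case True
  show ?thesis
  proof (cases "a \<in> idx n \<and> b \<in> idx n")
    case ab: True
    show ?thesis unfolding True using ab
      by (simp add: supercomm_def Q_def distrib_left distrib_right C_F_left C_F_right par_uminus[where n = n]
          sg_plus_one sg_add sg_diff sg_uminus add.assoc)
  next
    case False
    then show ?thesis by (simp add: Q_outside)
  qed
next
  case False
  then show ?thesis by (intro supercomm_Q C_supercomm_F)
qed

lemma C_supercomm_D: "supercomm 1 (C i) (par a + par b) (D k a b)"
  by (intro supercomm_D C_supercomm_Q supercomm_sym[OF supercomm_C] g_supercomm)

lemma C_supercomm_X: "i \<noteq> j \<Longrightarrow> supercomm 1 (C i) 0 (X j)"
  by (intro supercomm_X C_supercomm_D C_supercomm_F)

lemma S_C: "i \<noteq> j \<Longrightarrow> S i j * C i = C j * S i j" "i \<noteq> j \<Longrightarrow> S i j * C j = C i * S i j"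
  unfolding C_def by (simp_all add: sum_distrib_left sum_distrib_right S_F_left S_F_right)

lemma S_supercomm_C: "k \<noteq> i \<Longrightarrow> k \<noteq> j \<Longrightarrow> supercomm 0 (S i j) 1 (C k)"
  by (rule supercomm_C, rule S_supercomm_F)

lemma S_supercomm_S:
  "i \<noteq> k \<Longrightarrow> i \<noteq> l \<Longrightarrow> j \<noteq> k \<Longrightarrow> j \<noteq> l \<Longrightarrow> supercomm 0 (S i j) 0 (S k l)"
  by (intro supercomm_S S_supercomm_F) auto

text \<open>Conjugation by one flip moves a leg of the other. The braid relation follows, both sides being
  the flip of the outer factors.\<close>

lemma S_conj_S:
  assumes "i \<noteq> j" "k \<noteq> i" "k \<noteq> j" shows "S i j * S j k = S i k * S i j" "S j k * S i j = S i k * S j k"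
proof -
  have F: "S i j * (F j a b * F k b a) = F i a b * F k b a * S i j" for a b
    using supercommD[OF S_supercomm_F[OF assms(2,3), of b a]]
    by (simp add: S_F_right[OF assms(1)] mult.assoc flip: mult.assoc[of "S i j"])
  show "S i j * S j k = S i k * S i j"
    by (simp add: S_def[of j k] S_def[of i k] sum_distrib_left sum_distrib_right F)
  have G: "S j k * (F i a b * F j b a) = F i a b * F k b a * S j k" for a b
    using supercommD[OF S_supercomm_F[of i j k a b]] assms
    by (simp add: S_F_left mult.assoc flip: mult.assoc[of "S j k"])
  show "S j k * S i j = S i k * S j k"
    by (simp add: S_def[of i j] S_def[of i k] sum_distrib_left sum_distrib_right G)
qed

lemma P_S: "S i j * P = S i j" "P * S i j = S i j" if "i \<in> {1..d}" "j \<in> {1..d}"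
  using that
  by (simp_all add: S_def sum_distrib_left sum_distrib_right mult.assoc P_F flip: mult.assoc[of P])

lemma S_braid:
  assumes "i \<noteq> j" "k \<noteq> i" "k \<noteq> j" "i \<in> {1..d}" "j \<in> {1..d}" "k \<in> {1..d}"
  shows "S i j * S j k * S i j = S j k * S i j * S j k"
proof -
  have "S i j * S j k * S i j = S i k * (S i j * S i j)" "S j k * S i j * S j k = S i k * (S j k * S j k)"
    by (simp_all only: S_conj_S[OF assms(1-3)] mult.assoc)
  then show ?thesis using assms by (simp add: S_square P_S)
qed

text \<open>If \<open>k > i\<close>, the flip exchanges the two summands \<open>Q i\<close> and \<open>Q (i + 1)\<close>; if \<open>k < i\<close>, it does not
  meet factors \<open>0\<close> to \<open>k\<close>. For \<open>k = i\<close> the flip and \<open>D i\<close> do not commute, which is where the inhomogeneous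
  relation \<open>S_X\<close> comes from.\<close>

lemma S_supercomm_D:
  assumes "k \<noteq> i" "i \<ge> 1"
  shows "supercomm 0 (S i (i + 1)) (par a + par b) (D k a b)"
proof -
  let ?A = "{1..k} - {i, i + 1}"
  have g: "supercomm 0 (S i (i + 1)) (par a + par b) (g a b)"
    by (rule supercomm_sym, rule supercomm_S) (rule g_supercomm)+
  have A: "supercomm 0 (S i (i + 1)) (par a + par b) (\<Sum>j\<in>?A. Q j a b)"
    by (rule supercomm_sum, rule supercomm_Q, rule S_supercomm_F) auto
  show ?thesis
  proof (cases "k < i")
    case True
    then have "?A = {1..k}" by auto
    then show ?thesis unfolding D_def using supercomm_add[OF g A] by simp
  next
    case False
    then have "{1..k} = insert i (insert (i + 1) ?A)" using assms by auto
    then have "(\<Sum>j=1..k. Q j a b) = (\<Sum>j\<in>insert i (insert (i + 1) ?A). Q j a b)"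
      by (rule sum.cong[OF _ refl])
    also have "\<dots> = (Q i a b + Q (i + 1) a b) + (\<Sum>j\<in>?A. Q j a b)"
      by (simp add: add.assoc)
    finally have D: "D k a b = g a b + ((Q i a b + Q (i + 1) a b) + (\<Sum>j\<in>?A. Q j a b))"
      unfolding D_def by simp
    have Q: "supercomm 0 (S i (i + 1)) (par a + par b) (Q i a b + Q (i + 1) a b)"
      by (simp add: supercomm_def Q_def distrib_left distrib_right S_F_left S_F_right)
    show ?thesis unfolding D by (rule supercomm_add[OF g supercomm_add[OF Q A]])
  qed
qed

lemma S_supercomm_X:
  assumes "i \<ge> 1" "j \<noteq> i" "j \<noteq> i + 1"
  shows "supercomm 0 (S i (i + 1)) 0 (X j)"
  using assms by (intro supercomm_X S_supercomm_D S_supercomm_F) auto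

text \<open>The left side is \<open>\<Omega>\<close> for the module \<open>V\<close>. Its part with \<open>E\<^bsub>ab\<^esub>\<close> is the flip, and its part with
  \<open>E\<^bsub>-a,-b\<^esub>\<close> is \<open>- C\<^sub>i S C\<^sub>i = - C\<^sub>i C\<^sub>j S\<close>, since left and right multiplication by \<open>C\<close> negate the row and the
  column index of a matrix unit.\<close>

lemma Omega_on_V:
  assumes "i \<noteq> j"
  shows "(\<Sum>a\<in>idx n. \<Sum>b\<in>idx n. sg (par b) (Q i a b * F j b a)) = S i j - C i * (C j * S i j)"
proof -
  have 1: "sg (par b) (C i * (F i a b * F j b a) * C i) = - sg (par b) (F i (- a) (- b) * F j b a)"
    for a b
  proof -
    have "F j b a * C i = sg (par a + par b) (C i * F j b a)"
      using supercommD[OF supercomm_sym[OF C_supercomm_F[OF assms, of b a]]] by (simp add: add.commute)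
    then have "C i * (F i a b * F j b a) * C i = sg (par a + par b) (C i * F i a b * C i * F j b a)"
      by (simp add: mult.assoc)
    also have "C i * F i a b * C i = - sg (par a + par b) (F i (- a) (- b))"
      by (simp add: C_F_left C_F_right sg_uminus)
    finally show ?thesis by (simp add: sg_uminus add.assoc)
  qed
  have "C i * (C j * S i j) = C i * S i j * C i"
    by (simp add: S_C[OF assms] mult.assoc)
  also have "\<dots> = (\<Sum>a\<in>idx n. \<Sum>b\<in>idx n. sg (par b) (C i * (F i a b * F j b a) * C i))"
    by (simp add: S_def sum_distrib_left sum_distrib_right)
  also have "\<dots> = - (\<Sum>a\<in>idx n. \<Sum>b\<in>idx n. sg (par b) (F i (- a) (- b) * F j b a))"
    by (simp add: 1 sum_negf)
  finally show ?thesis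
    by (simp add: S_def Q_def distrib_right sg_add sum.distrib)
qed

text \<open>\<open>X (i + 1)\<close> is the conjugate of \<open>X i\<close> under the flip plus \<open>(1 - C\<^sub>i C\<^bsub>i+1\<^esub>) S\<close>, and multiplying the
  last term by the flip leaves \<open>1 - C\<^sub>i C\<^bsub>i+1\<^esub>\<close>.\<close>

lemma S_X:
  assumes "i \<in> {1..d}" "i + 1 \<in> {1..d}"
  shows "S i (i + 1) * X i = X (i + 1) * S i (i + 1) - P + C i * C (i + 1)"
proof -
  let ?S = "S i (i + 1)"
  have i: "i - 1 \<noteq> i" "i \<ge> 1" using assms by auto
  have D: "D i a b = D (i - 1) a b + Q i a b" for a b
    using D_Suc[of "i - 1" a b] assms by simp
  have 1: "X (i + 1) = (\<Sum>a\<in>idx n. \<Sum>b\<in>idx n. sg (par b) (D (i - 1) a b * F (i + 1) b a))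
      + (?S - C i * (C (i + 1) * ?S))"
    by (simp add: X_def D Omega_on_V[symmetric] distrib_right sg_add sum.distrib)
  have "?S * (D (i - 1) a b * F i b a) = D (i - 1) a b * F (i + 1) b a * ?S" for a b
  proof -
    have "?S * D (i - 1) a b = D (i - 1) a b * ?S"
      using supercommD[OF S_supercomm_D[OF i, of a b]] by simp
    then have "?S * (D (i - 1) a b * F i b a) = D (i - 1) a b * (?S * F i b a)"
      by (simp only: flip: mult.assoc)
    then show ?thesis by (simp add: S_F_left mult.assoc)
  qed
  then have "?S * X i =
      (\<Sum>a\<in>idx n. \<Sum>b\<in>idx n. sg (par b) (D (i - 1) a b * F (i + 1) b a)) * ?S"
    by (simp add: X_def sum_distrib_left sum_distrib_right)
  also have "\<dots> = (X (i + 1) - (?S - C i * (C (i + 1) * ?S))) * ?S"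
    using 1 by simp
  also have "\<dots> = X (i + 1) * ?S - P + C i * C (i + 1)"
    using assms by (simp add: left_diff_distrib mult.assoc S_square C_P)
  finally show ?thesis .
qed

lemma D_uminus: "D k (- a) (- b) = D k a b"
  using D_family by (simp add: q_family_def)

text \<open>\<open>C\<^sub>i X\<^sub>i\<close> has \<open>E\<^bsub>-b,a\<^esub>\<close> where \<open>- X\<^sub>i C\<^sub>i\<close> has \<open>E\<^bsub>b,-a\<^esub>\<close>. The substitution \<open>(a, b) \<mapsto> (-a, -b)\<close>, which
  fixes \<open>q\<^bsub>ab\<^esub>\<close>, identifies them.\<close>

lemma C_X:
  assumes "i \<ge> 1" shows "C i * X i = - (X i * C i)"
proof -
  let ?D = "D (i - 1)"
  have "C i * (?D a b * F i b a) = sg (par a) (?D a b * F i (- b) a)" for a b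
    using supercommD[OF C_supercomm_D[of i a b "i - 1"]]
    by (simp add: mult.assoc C_F_left add.assoc flip: mult.assoc[of "C i"])
  then have "C i * X i = (\<Sum>a\<in>idx n. \<Sum>b\<in>idx n. sg (par b + par a) (?D a b * F i (- b) a))"
    by (simp add: X_def sum_distrib_left)
  also have "\<dots> = (\<Sum>a\<in>idx n. \<Sum>b\<in>idx n. sg (par b + par (- a)) (?D (- a) b * F i (- b) (- a)))"
    using sum_idx_uminus[of "\<lambda>a. \<Sum>b\<in>idx n. sg (par b + par a) (?D a b * F i (- b) a)" n] by simp
  also have "\<dots> = (\<Sum>a\<in>idx n. \<Sum>b\<in>idx n. sg (par (- b) + par (- a)) (?D (- a) (- b) * F i b (- a)))"
  proof (rule sum.cong[OF refl])
    fix a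
    show "(\<Sum>b\<in>idx n. sg (par b + par (- a)) (?D (- a) b * F i (- b) (- a))) =
      (\<Sum>b\<in>idx n. sg (par (- b) + par (- a)) (?D (- a) (- b) * F i b (- a)))"
    using sum_idx_uminus[of "\<lambda>b. sg (par b + par (- a)) (?D (- a) b * F i (- b) (- a))" n] by simp
  qed
  also have "\<dots> = (\<Sum>a\<in>idx n. \<Sum>b\<in>idx n. sg (par b + par a) (?D a b * F i b (- a)))"
  proof (intro sum.cong refl)
    fix a b assume "a \<in> idx n" "b \<in> idx n"
    then have "par (- b) + par (- a) = par b + par a"
      by (simp add: par_add_uminus)
    then show "sg (par (- b) + par (- a)) (?D (- a) (- b) * F i b (- a)) =
        sg (par b + par a) (?D a b * F i b (- a))"
      by (simp add: D_uminus)
  qed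
  also have "\<dots> = - (X i * C i)"
    by (simp add: X_def sum_distrib_right mult.assoc C_F_right sg_uminus sum_negf)
  finally show ?thesis .
qed

lemma X_supercomm_F: "i < j \<Longrightarrow> i \<ge> 1 \<Longrightarrow> supercomm 0 (X i) (par a + par b) (F j a b)"
  by (rule supercomm_sym, rule supercomm_X) (auto intro: F_supercomm supercomm_sym[OF D_supercomm_F])

text \<open>Invariance of \<open>\<Omega>\<close>. The bracket of \<open>q\<^bsub>ce\<^esub>\<close> with the first leg gives four families of terms, and so does the
  bracket with the second leg. After the forced index is eliminated they cancel in pairs: two
  pairs by the parity identities \<open>s1\<close> and \<open>s2\<close>, one pair literally, and one by
  \<open>q\<^bsub>-c,b\<^esub> = q\<^bsub>c,-b\<^esub>\<close>.\<close>

lemma D_commutes_X: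
  assumes "i \<ge> 1" shows "D i c e * X i = X i * D i c e"
proof (cases "c \<in> idx n \<and> e \<in> idx n")
  case False
  then have "D i c e = 0" using D_family[of i] unfolding q_family_def by blast
  then show ?thesis by simp
next
  case True
  define H where "H = D (i - 1)"
  have D: "D i c e = H c e + Q i c e"
    unfolding H_def using D_Suc[of "i - 1" c e] assms by simp
  define s where "s a b = (par c + par e) * (par a + par b)" for a b
  have 1: "H c e * (H a b * F i b a) - H a b * F i b a * H c e =
      delta n e a (H c b * F i b a) + delta n e (- a) (H c (- b) * F i b a)
      - delta n b c (sg (s a b) (H a e * F i b a)) - delta n b (- c) (sg (s a b) (H a (- e) * F i b a))"
    for a b
  proof -
    have "F i b a * H c e = sg (s a b) (H c e * F i b a)"
      unfolding H_def using supercommD[OF supercomm_sym[OF D_supercomm_F[of "i - 1" i c e b a]]] assms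
      by (simp add: s_def mult.commute add.commute)
    then have "H c e * (H a b * F i b a) - H a b * F i b a * H c e =
      (H c e * H a b - sg (s a b) (H a b * H c e)) * F i b a"
      by (simp add: left_diff_distrib mult.assoc)
    also have "H c e * H a b - sg (s a b) (H a b * H c e) =
        delta n e a (H c b) + delta n e (- a) (H c (- b))
        - sg (s a b) (delta n b c (H a e) + delta n b (- c) (H a (- e)))"
      using D_family[of "i - 1"] unfolding q_family_def s_def H_def by blast
    finally show ?thesis
      by (simp add: left_diff_distrib distrib_right sg_add delta_sg)
  qed
  have 2: "Q i c e * (H a b * F i b a) - H a b * F i b a * Q i c e =
      delta n e b (sg (s a b) (H a b * F i c a)) + delta n (- e) b (sg (s a b) (H a b * F i (- c) a))
      - delta n a c (H a b * F i b e) - delta n a (- c) (H a b * F i b (- e))" for a b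
  proof -
    have "supercomm (par c + par e) (Q i c e) (par a + par b) (H a b)"
      unfolding H_def using assms by (intro supercomm_sym[OF supercomm_Q] D_supercomm_F) simp
    then have "Q i c e * H a b = sg (s a b) (H a b * Q i c e)"
      by (simp add: supercomm_def s_def)
    then have "Q i c e * (H a b * F i b a) = sg (s a b) (H a b * (Q i c e * F i b a))"
      by (simp flip: mult.assoc)
    then show ?thesis
      by (simp add: Q_def distrib_left distrib_right F_mult delta_sg sg_add mult.assoc)
  qed
  have bit: "p + (p + q) * (r + p) = q + (p + q) * (r + q)" for p q r :: bit
    by (cases p; cases q; cases r; simp)
  have s1: "par c + s a c = par e + s a e" for a
    unfolding s_def by (rule bit)
  have s2: "par (- c) + s a (- c) = par (- e) + s a (- e)" for a
    using True by (cases "par a"; cases "par c"; cases "par e"; simp add: s_def par_uminus[where n = n])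
  have h: "H (- c) b = H c (- b)" for b
    using D_uminus[of "i - 1" c "- b"] by (simp add: H_def)
  have "D i c e * X i - X i * D i c e = (\<Sum>a\<in>idx n. \<Sum>b\<in>idx n.
      sg (par b) (D i c e * (H a b * F i b a) - H a b * F i b a * D i c e))"
    by (simp add: X_def H_def sum_distrib_left sum_distrib_right sg_diff sum_subtractf)
  also have "\<dots> = (\<Sum>a\<in>idx n. \<Sum>b\<in>idx n.
      sg (par b) ((H c e * (H a b * F i b a) - H a b * F i b a * H c e)
      + (Q i c e * (H a b * F i b a) - H a b * F i b a * Q i c e)))"
    by (simp add: D distrib_left distrib_right add_diff_add)
  also have "\<dots> = 0"
    unfolding 1 2 using True
    by (simp add: sg_add sg_diff sum.distrib sum_subtractf sum_negf delta_sg delta_sum sum_delta s1 s2 h)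
  finally show ?thesis by simp
qed

lemma X_supercomm_D:
  assumes "i \<ge> 1" "i \<le> k" shows "supercomm 0 (X i) (par c + par e) (D k c e)"
  using assms(2)
proof (induction k rule: dec_induct)
  case base
  then show ?case using D_commutes_X[OF assms(1)] by (simp add: supercomm_def)
next
  case (step k)
  have "supercomm 0 (X i) (par c + par e) (Q (Suc k) c e)"
    using step assms by (intro supercomm_Q X_supercomm_F) simp_all
  then show ?case unfolding D_Suc by (intro supercomm_add step.IH)
qed

lemma X_X:
  assumes "i \<ge> 1" "j \<ge> 1" shows "X i * X j = X j * X i"
proof -
  have "X i * X j = X j * X i" if "i < j" "i \<ge> 1" for i j
  proof -
    have "supercomm 0 (X i) 0 (X j)" using that by (intro supercomm_X X_supercomm_D X_supercomm_F) auto
    then show ?thesis by (simp add: supercomm_def)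
  qed
  then show ?thesis using assms by (cases i j rule: linorder_cases) simp_all
qed

end

section \<open>The modules of q(n)\<close>

lemma sum_apply: "(sum f A) x = (\<Sum>a\<in>A. f a x)"
  by (induction A rule: infinite_finite_induct) simp_all

lemma sg_apply: "sg p f x = sg p (f x)"
  by (simp add: sg_def)

text \<open>The doubled basis \<open>q\<^bsub>ab\<^esub>\<close> of \<open>q(n)\<close>, indexed by all pairs of indices.\<close>

definition q_mat :: "int \<Rightarrow> int \<Rightarrow> mat" where
  "q_mat a b = (\<lambda>x y. E a b x y + E (- a) (- b) x y)"

lemma q_mat_uminus: "q_mat (- a) (- b) = q_mat a b"
  by (simp add: q_mat_def add.commute)

lemma e_mat_q_mat: "e_mat a b = q_mat a b" and f_mat_q_mat: "f_mat a b = q_mat (- a) b"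
  by (simp_all add: e_mat_def f_mat_def q_mat_def)

lemma sum_E: "(\<Sum>k\<in>idx n. E a b x k * f k) = (if x = a \<and> b \<in> idx n then f b else 0)"
proof -
  have "(\<Sum>k\<in>idx n. E a b x k * f k) = (\<Sum>k\<in>idx n. if k = b then if x = a then f k else 0 else 0)"
    by (rule sum.cong) (auto simp: E_def)
  then show ?thesis by simp
qed

lemma mat_mult_q_mat:
  assumes "b \<in> idx n"
  shows "mat_mult n (q_mat a b) (q_mat c e) = (\<lambda>x y.
    (if b = c then 1 else 0) * q_mat a e x y + (if b = - c then 1 else 0) * q_mat a (- e) x y)"
proof (intro ext)
  fix x y
  have "b \<noteq> 0" using assms by (simp add: idx_def)
  then show "mat_mult n (q_mat a b) (q_mat c e) x y =
    (if b = c then 1 else 0) * q_mat a e x y + (if b = - c then 1 else 0) * q_mat a (- e) x y"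
    using assms
    unfolding mat_mult_def q_mat_def
    by (simp add: distrib_right sum.distrib sum_E) (auto simp: E_def)
qed

lemma idx_pos_idx: "a \<in> idx_pos n \<Longrightarrow> a \<in> idx n"
  by (auto simp: idx_pos_def idx_def)

lemma idx_cases: "a \<in> idx n \<Longrightarrow> (a \<in> idx_pos n \<and> par a = 0) \<or> (- a \<in> idx_pos n \<and> par a = 1)"
  by (auto simp: idx_pos_def idx_def par_def)

lemma e_f_mat_in_q_part: "a \<in> idx_pos n \<Longrightarrow> b \<in> idx_pos n \<Longrightarrow> (if p = 0 then e_mat a b else f_mat a b) \<in> q_part n p"
proof -
  assume ab: "a \<in> idx_pos n" "b \<in> idx_pos n"
  have fin: "finite (idx_pos n)" by (simp add: idx_pos_def)
  let ?h = "\<lambda>i j. if p = 0 then e_mat i j else f_mat i j"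
  have *: "(\<Sum>j\<in>idx_pos n. (if i = a \<and> j = b then 1 else 0) * ?h i j x y) =
      (if i = a then ?h a b x y else 0)" for i x y
  proof -
    have "(\<Sum>j\<in>idx_pos n. (if i = a \<and> j = b then 1 else 0) * ?h i j x y) =
      (\<Sum>j\<in>idx_pos n. if j = b then if i = a then ?h i j x y else 0 else 0)"
      by (rule sum.cong) auto
    then show ?thesis using ab fin by simp
  qed
  show ?thesis
    unfolding q_part_def mem_Collect_eq
    by (rule exI[of _ "\<lambda>i j. if i = a \<and> j = b then 1 else 0"]) (simp only: *, use ab fin in simp)
qed

lemma q_mat_in_q_part:
  assumes "a \<in> idx n" "b \<in> idx n" shows "q_mat a b \<in> q_part n (par a + par b)"
  using idx_cases[OF assms(1)] idx_cases[OF assms(2)]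
    e_f_mat_in_q_part[of a n b "par a + par b"] e_f_mat_in_q_part[of "- a" n b "par a + par b"]
    e_f_mat_in_q_part[of a n "- b" "par a + par b"] e_f_mat_in_q_part[of "- a" n "- b" "par a + par b"]
  by (auto simp: e_mat_q_mat f_mat_q_mat q_mat_uminus)

lemma zero_in_q_part: "(\<lambda>a b. 0) \<in> q_part n p"
  unfolding q_part_def by (auto intro!: exI[of _ "\<lambda>i j. 0"])

lemma q_algI:
  assumes "x \<in> q_part n 0" "y \<in> q_part n 1" "\<And>a b. z a b = x a b + y a b"
  shows "z \<in> q_alg n"
proof -
  have "z = (\<lambda>a b. x a b + y a b)" using assms(3) by (intro ext)
  then show ?thesis unfolding q_alg_def using assms(1,2) by (intro CollectI exI conjI)
qed

lemma q_algE:
  assumes "z \<in> q_alg n"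
  obtains x y where "x \<in> q_part n 0" "y \<in> q_part n 1" "z = (\<lambda>a b. x a b + y a b)"
  using assms unfolding q_alg_def mem_Collect_eq by (elim exE conjE)

lemma q_part_q_alg:
  assumes "x \<in> q_part n p" shows "x \<in> q_alg n"
proof (cases p)
  case zero
  show ?thesis by (rule q_algI[OF _ zero_in_q_part]) (use assms zero in simp_all)
next
  case one
  show ?thesis by (rule q_algI[OF zero_in_q_part]) (use assms one in simp_all)
qed

lemma q_mat_in_q_alg: "a \<in> idx n \<Longrightarrow> b \<in> idx n \<Longrightarrow> q_mat a b \<in> q_alg n"
  by (rule q_part_q_alg, rule q_mat_in_q_part)

lemma q_partE:
  assumes "x \<in> q_part n p"
  obtains \<alpha> where "x = (\<lambda>a b. \<Sum>i\<in>idx_pos n. \<Sum>j\<in>idx_pos n.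
    \<alpha> i j * (if p = 0 then e_mat i j else f_mat i j) a b)"
  using assms unfolding q_part_def mem_Collect_eq by (elim exE)

lemma q_part_add:
  assumes "x \<in> q_part n p" "y \<in> q_part n p" shows "(\<lambda>a b. x a b + y a b) \<in> q_part n p"
proof -
  obtain \<alpha> where
    x: "x = (\<lambda>a b. \<Sum>i\<in>idx_pos n. \<Sum>j\<in>idx_pos n. \<alpha> i j * (if p = 0 then e_mat i j else f_mat i j) a b)"
    by (rule q_partE[OF assms(1)])
  obtain \<beta> where
    y: "y = (\<lambda>a b. \<Sum>i\<in>idx_pos n. \<Sum>j\<in>idx_pos n. \<beta> i j * (if p = 0 then e_mat i j else f_mat i j) a b)"
    by (rule q_partE[OF assms(2)])
  show ?thesis unfolding q_part_def mem_Collect_eq x y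
    by (rule exI[of _ "\<lambda>i j. \<alpha> i j + \<beta> i j"]) (simp only: distrib_right sum.distrib)
qed

lemma q_part_scale:
  assumes "x \<in> q_part n p" shows "(\<lambda>a b. c * x a b) \<in> q_part n p"
proof -
  obtain \<alpha> where
    x: "x = (\<lambda>a b. \<Sum>i\<in>idx_pos n. \<Sum>j\<in>idx_pos n. \<alpha> i j * (if p = 0 then e_mat i j else f_mat i j) a b)"
    by (rule q_partE[OF assms])
  show ?thesis unfolding q_part_def mem_Collect_eq x
    by (rule exI[of _ "\<lambda>i j. c * \<alpha> i j"]) (simp only: sum_distrib_left mult.assoc)
qed

lemma q_alg_add:
  assumes "x \<in> q_alg n" "y \<in> q_alg n" shows "(\<lambda>a b. x a b + y a b) \<in> q_alg n"
proof (rule q_algE[OF assms(1)], rule q_algE[OF assms(2)])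
  fix x0 x1 y0 y1
  assume *: "x0 \<in> q_part n 0" "x1 \<in> q_part n 1" "y0 \<in> q_part n 0" "y1 \<in> q_part n 1"
    "x = (\<lambda>a b. x0 a b + x1 a b)" "y = (\<lambda>a b. y0 a b + y1 a b)"
  show ?thesis by (rule q_algI[OF q_part_add[OF *(1,3)] q_part_add[OF *(2,4)]]) (simp add: *(5,6))
qed

lemma q_alg_scale:
  assumes "x \<in> q_alg n" shows "(\<lambda>a b. c * x a b) \<in> q_alg n"
proof (rule q_algE[OF assms])
  fix x0 x1 assume *: "x0 \<in> q_part n 0" "x1 \<in> q_part n 1" "x = (\<lambda>a b. x0 a b + x1 a b)"
  show ?thesis by (rule q_algI[OF q_part_scale[OF *(1)] q_part_scale[OF *(2)]]) (simp add: *(3) distrib_left)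
qed

context q_supermodule
begin

lemma sc_ssign: "sc (ssign p) m = sg p m"
  by (simp add: ssign_def sg_def)

lemma sc_sg: "sc c (sg p m) = sg p (sc c m)"
  by (simp add: sg_def)

lemma sc_ssign_mult: "sc (ssign p * c) m = sg p (sc c m)"
  by (simp add: ssign_def sg_def)

lemma sg_in_part: "m \<in> M p \<Longrightarrow> sg q m \<in> M p"
  using subspace_part[of p] by (simp add: sg_def subspace_neg)

text \<open>The parity involution below is understood through homogeneous elements; identities that involve it
  are checked there.\<close>

lemma homogeneous_eqI:
  assumes "\<And>x y. f (x + y) = f x + f y" "\<And>x y. h (x + y) = h x + h y"
    and "\<And>p m. m \<in> M p \<Longrightarrow> f m = (h m :: 'b::plus)"
  shows "f m = h m"
  using parts_span[of m] assms by metis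

lemma component_unique:
  assumes "a \<in> M p" "m - a \<in> M (p + 1)" shows "component M p m = a"
  unfolding component_def
proof (rule the_equality)
  show "a \<in> M p \<and> m - a \<in> M (p + 1)" using assms by simp
  fix b assume b: "b \<in> M p \<and> m - b \<in> M (p + 1)"
  have "b - a \<in> M p" using b assms subspace_part subspace_diff by blast
  moreover have "b - a = (m - a) - (m - b)" by simp
  then have "b - a \<in> M (p + 1)" using b assms subspace_part subspace_diff by metis
  ultimately have "b - a \<in> M 0 \<inter> M 1" by (cases p) auto
  then have "b - a = 0" using parts_disjoint by auto
  then show "b = a" by simp
qed

lemma component_props: "component M p m \<in> M p" "m - component M p m \<in> M (p + 1)"
proof -
  obtain a b where "a \<in> M 0" "b \<in> M 1" "m = a + b" using parts_span by blast
  then have "\<exists>c\<in>M p. m - c \<in> M (p + 1)"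
    by (cases p) (auto intro: bexI[of _ a] bexI[of _ b])
  then show "component M p m \<in> M p" "m - component M p m \<in> M (p + 1)"
    using component_unique by auto
qed

lemma component_add: "component M p (x + y) = component M p x + component M p y"
proof (rule component_unique)
  show "component M p x + component M p y \<in> M p"
    using component_props subspace_part subspace_add by blast
  have "x + y - (component M p x + component M p y) = (x - component M p x) + (y - component M p y)"
    by simp
  then show "x + y - (component M p x + component M p y) \<in> M (p + 1)"
    using component_props subspace_part subspace_add by metis
qed

text \<open>The \<open>p\<close>-th power of the parity involution of the module. Moving an operator of parity \<open>p\<close> past
  factor \<open>0\<close> applies it.\<close>

definition twist :: "bit \<Rightarrow> 'm \<Rightarrow> 'm" where
  "twist p m = component M 0 m + sg p (component M 1 m)"

lemma twist_add: "twist p (x + y) = twist p x + twist p y"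
  by (simp add: twist_def component_add sg_add algebra_simps)

lemma twist_homogeneous: "m \<in> M q \<Longrightarrow> twist p m = sg (p * q) m"
  by (cases q) (simp_all add: twist_def component_homogeneous)

lemma twist_zero [simp]: "twist p 0 = 0"
  using twist_add[of p 0 0] by simp

lemma twist_minus: "twist p (- x) = - twist p x"
  using twist_add[of p x "- x"] by (simp add: eq_neg_iff_add_eq_0 add.commute)

lemma twist_sg: "twist p (sg q x) = sg q (twist p x)"
  by (simp add: sg_def twist_minus)

lemma twist_0 [simp]: "twist 0 m = m"
  by (rule homogeneous_eqI[of "twist 0" "\<lambda>m. m"]) (simp_all add: twist_add twist_homogeneous)

lemma twist_twist: "twist p (twist q m) = twist (p + q) m"
  by (rule homogeneous_eqI[of "\<lambda>m. twist p (twist q m)" "twist (p + q)"])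
    (simp_all add: twist_add twist_homogeneous twist_sg distrib_right add.commute)

lemma twist_in_part: "m \<in> M q \<Longrightarrow> twist p m \<in> M q"
  by (simp add: twist_homogeneous sg_in_part)

lemma twist_scale: "twist p (sc c m) = sc c (twist p m)"
proof (rule homogeneous_eqI[of "\<lambda>m. twist p (sc c m)" "\<lambda>m. sc c (twist p m)"])
  fix q m assume "m \<in> M q"
  moreover from this have "sc c m \<in> M q" using subspace_part subspace_scale by blast
  ultimately show "twist p (sc c m) = sc c (twist p m)" by (simp add: twist_homogeneous sc_sg)
qed (simp_all add: twist_add scale_right_distrib)

lemma action_linear:
  assumes "x \<in> q_alg n"
  shows "\<rho> x (u + v) = \<rho> x u + \<rho> x v" "\<rho> x (sc c u) = sc c (\<rho> x u)" "\<rho> x 0 = 0" "\<rho> x (sg p u) = sg p (\<rho> x u)"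
proof -
  interpret l: Vector_Spaces.linear sc sc "\<rho> x" by (rule linear_action[OF assms])
  show "\<rho> x (u + v) = \<rho> x u + \<rho> x v" "\<rho> x (sc c u) = sc c (\<rho> x u)" "\<rho> x 0 = 0"
    by (simp_all add: l.add l.scale)
  show "\<rho> x (sg p u) = sg p (\<rho> x u)" by (simp add: sg_def l.neg)
qed

lemma action_twist:
  assumes x: "x \<in> q_part n r" shows "\<rho> x (twist p m) = sg (p * r) (twist p (\<rho> x m))"
proof (rule homogeneous_eqI[of "\<lambda>m. \<rho> x (twist p m)" "\<lambda>m. sg (p * r) (twist p (\<rho> x m))"])
  fix q m assume m: "m \<in> M q"
  then have "\<rho> x m \<in> M (r + q)" using action_parity x by blast
  then show "\<rho> x (twist p m) = sg (p * r) (twist p (\<rho> x m))"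
    using m by (simp add: twist_homogeneous action_linear[OF q_part_q_alg[OF x]] distrib_left)
qed (simp_all add: twist_add action_linear[OF q_part_q_alg[OF x]] sg_add)

text \<open>The bracket axiom in the form required by \<open>q_family\<close>.\<close>

lemma action_q_mat_bracket:
  assumes "a \<in> idx n" "b \<in> idx n" "c \<in> idx n" "e \<in> idx n"
  defines "s \<equiv> (par a + par b) * (par c + par e)"
  shows "\<rho> (q_mat a b) (\<rho> (q_mat c e) m) - sg s (\<rho> (q_mat c e) (\<rho> (q_mat a b) m)) =
    delta n b c (\<rho> (q_mat a e) m) + delta n b (- c) (\<rho> (q_mat a (- e)) m)
    - sg s (delta n e a (\<rho> (q_mat c b) m) + delta n e (- a) (\<rho> (q_mat c (- b)) m))"
proof -
  have mem: "q_mat a e \<in> q_alg n" "q_mat a (- e) \<in> q_alg n" "q_mat c b \<in> q_alg n" "q_mat c (- b) \<in> q_alg n"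
    using assms by (auto intro: q_mat_in_q_alg)
  have lin: "\<rho> (\<lambda>x y. (\<alpha> * A x y + \<beta> * B x y) + \<gamma> * (\<alpha>' * A' x y + \<beta>' * B' x y)) m =
     sc \<alpha> (\<rho> A m) + sc \<beta> (\<rho> B m) + sc \<gamma> (sc \<alpha>' (\<rho> A' m) + sc \<beta>' (\<rho> B' m))"
    if "A \<in> q_alg n" "B \<in> q_alg n" "A' \<in> q_alg n" "B' \<in> q_alg n" for \<alpha> \<beta> \<gamma> \<alpha>' \<beta>' A B A' B'
  proof -
    have 1: "\<rho> (\<lambda>x y. \<alpha> * A x y + \<beta> * B x y) m = sc \<alpha> (\<rho> A m) + sc \<beta> (\<rho> B m)"
      if "A \<in> q_alg n" "B \<in> q_alg n" for A B \<alpha> \<beta>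
      using action_add[OF q_alg_scale[OF that(1)] q_alg_scale[OF that(2)], of \<alpha> \<beta>]
      by (simp add: action_scale that)
    have 2: "(\<lambda>x y. \<alpha> * A x y + \<beta> * B x y) \<in> q_alg n" "(\<lambda>x y. \<alpha>' * A' x y + \<beta>' * B' x y) \<in> q_alg n"
      using that by (auto intro!: q_alg_add q_alg_scale)
    have "\<rho> (\<lambda>x y. (\<alpha> * A x y + \<beta> * B x y) + \<gamma> * (\<alpha>' * A' x y + \<beta>' * B' x y)) m =
        \<rho> (\<lambda>x y. \<alpha> * A x y + \<beta> * B x y) m + \<rho> (\<lambda>x y. \<gamma> * (\<alpha>' * A' x y + \<beta>' * B' x y)) m"
      by (rule action_add[OF 2(1) q_alg_scale[OF 2(2)]])
    then show ?thesis using 1 that action_scale[OF 2(2)] by simp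
  qed
  have "\<rho> (q_mat a b) (\<rho> (q_mat c e) m) - sg s (\<rho> (q_mat c e) (\<rho> (q_mat a b) m)) =
      \<rho> (sbracket n (par a + par b) (par c + par e) (q_mat a b) (q_mat c e)) m"
    using action_bracket[OF q_mat_in_q_part q_mat_in_q_part, of a b c e m] assms
    by (simp add: sc_ssign)
  also have "sbracket n (par a + par b) (par c + par e) (q_mat a b) (q_mat c e) =
      (\<lambda>x y. ((if b = c then 1 else 0) * q_mat a e x y + (if b = - c then 1 else 0) * q_mat a (- e) x y)
      + (- ssign s) * ((if e = a then 1 else 0) * q_mat c b x y + (if e = - a then 1 else 0) * q_mat c (- b) x y))"
    unfolding sbracket_def mat_mult_q_mat[OF assms(2)] mat_mult_q_mat[OF assms(4)] s_def by simp
  also have "\<rho> \<dots> m = delta n b c (\<rho> (q_mat a e) m) + delta n b (- c) (\<rho> (q_mat a (- e)) m)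
    - sg s (delta n e a (\<rho> (q_mat c b) m) + delta n e (- a) (\<rho> (q_mat c (- b)) m))"
    unfolding lin[OF mem] using assms(2,4)
    by (simp add: delta_def scale_minus_left sc_ssign)
  finally show ?thesis .
qed

end

section \<open>The operators on the tensor space\<close>

lemma finite_idx_pos [simp]: "finite (idx_pos n)"
  by (simp add: idx_pos_def)

lemma sum_idx_idx_pos: "(\<Sum>a\<in>idx n. f a) = (\<Sum>a\<in>idx_pos n. f a + f (- a))"
proof -
  have "idx n = idx_pos n \<union> uminus ` idx_pos n"
    by (auto simp: idx_def idx_pos_def image_iff)
  moreover have "idx_pos n \<inter> uminus ` idx_pos n = {}"
    by (auto simp: idx_pos_def)
  ultimately have "(\<Sum>a\<in>idx n. f a) = (\<Sum>a\<in>idx_pos n. f a) + (\<Sum>a\<in>uminus ` idx_pos n. f a)"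
    by (simp add: sum.union_disjoint)
  also have "(\<Sum>a\<in>uminus ` idx_pos n. f a) = (\<Sum>a\<in>idx_pos n. f (- a))"
    by (simp add: sum.reindex)
  finally show ?thesis by (simp add: sum.distrib)
qed

definition prefix_par :: "int list \<Rightarrow> nat \<Rightarrow> bit" where
  "prefix_par w i = sum_list (map par (take (i - 1) w))"

lemma words_update:
  "w \<in> words n d \<Longrightarrow> b \<in> idx n \<Longrightarrow> w[i := b] \<in> words n d"
  using set_update_subset_insert[of w i b] by (auto simp: words_def)

lemma words_nth: "w \<in> words n d \<Longrightarrow> i \<in> {1..d} \<Longrightarrow> w ! (i - 1) \<in> idx n"
  by (auto simp: words_def intro!: subsetD[OF _ nth_mem])

lemma words_length: "w \<in> words n d \<Longrightarrow> length w = d"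
  by (simp add: words_def)

lemma prefix_par_update_ge: "i - 1 \<le> k \<Longrightarrow> prefix_par (w[k := b]) i = prefix_par w i"
  by (simp add: prefix_par_def)

lemma sum_list_update_par:
  "k < length w \<Longrightarrow> sum_list (map par (w[k := b])) = sum_list (map par w) + par (w ! k) + par b"
proof (induction w arbitrary: k)
  case (Cons x w)
  then show ?case by (cases k) (simp_all add: algebra_simps)
qed simp

text \<open>This change of sign is why operators in different factors supercommute instead of commuting.\<close>

lemma prefix_par_update_less:
  assumes "k < j - 1" "j \<le> length w"
  shows "prefix_par (w[k := b]) j = prefix_par w j + par (w ! k) + par b"
  using assms sum_list_update_par[of k "take (j - 1) w" b]
  by (simp add: prefix_par_def take_update_swap)

lemma delta_outside: "a \<notin> idx n \<or> b \<notin> idx n \<Longrightarrow> delta n a b x = 0"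
  by (auto simp: delta_def)

locale q_tensor = q_supermodule sc n M \<rho>
  for sc :: "complex \<Rightarrow> 'm::ab_group_add \<Rightarrow> 'm" and n M \<rho> +
  fixes d :: nat
begin

text \<open>The matrix unit in factor \<open>i\<close>, with its sign separated into a contribution of the letters before
  position \<open>i\<close> and the parity involution of the module. It is cut off to zero outside the valid
  factors, indices and words, so that the product rules hold unconditionally on all coefficient
  functions.\<close>

definition unit_fun :: "nat \<Rightarrow> int \<Rightarrow> int \<Rightarrow> 'm tensor \<Rightarrow> 'm tensor" where
  "unit_fun i a b t w =
     (if i \<in> {1..d} \<and> a \<in> idx n \<and> b \<in> idx n \<and> w \<in> words n d \<and> w ! (i - 1) = a
      then sg ((par a + par b) * prefix_par w i) (twist (par a + par b) (t (w[i - 1 := b]))) else 0)"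

definition F :: "nat \<Rightarrow> int \<Rightarrow> int \<Rightarrow> 'm tensor add_endo" where
  "F i a b = Add_endo (unit_fun i a b)"

definition g :: "int \<Rightarrow> int \<Rightarrow> 'm tensor add_endo" where
  "g a b = Add_endo (\<lambda>t w. if a \<in> idx n \<and> b \<in> idx n \<and> w \<in> words n d then \<rho> (q_mat a b) (t w) else 0)"

definition P :: "'m tensor add_endo" where
  "P = Add_endo (\<lambda>t w. if w \<in> words n d then t w else 0)"

lemma apply_endo_F: "apply_endo (F i a b) = unit_fun i a b"
  unfolding F_def
  by (rule Add_endo_inverse) (auto simp: fun_eq_iff unit_fun_def twist_add sg_add)

lemma apply_endo_g: "apply_endo (g a b) = (\<lambda>t w. if a \<in> idx n \<and> b \<in> idx n \<and> w \<in> words n d then \<rho> (q_mat a b) (t w) else 0)"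
  unfolding g_def
  by (rule Add_endo_inverse) (auto simp: fun_eq_iff action_linear q_mat_in_q_alg)

lemma apply_endo_P: "apply_endo P t w = (if w \<in> words n d then t w else 0)"
  unfolding P_def by (subst Add_endo_inverse) (auto simp: fun_eq_iff)

lemma add_endo_ext: "(\<And>t w. apply_endo S t w = apply_endo T t w) \<Longrightarrow> S = T" for S T :: "'m tensor add_endo"
  by (rule add_endo_eqI, rule ext)

lemma F_outside: "a \<notin> idx n \<or> b \<notin> idx n \<Longrightarrow> F i a b = 0"
  by (rule add_endo_ext) (auto simp: apply_endo_F unit_fun_def)

lemma apply_endo_delta: "apply_endo (delta n a b T) t w = delta n a b (apply_endo T t w)"
  by (auto simp: delta_def)

lemma F_mult: "F i a b * F i c e = delta n b c (F i a e)"
proof (rule add_endo_ext)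
  fix t w
  show "apply_endo (F i a b * F i c e) t w = apply_endo (delta n b c (F i a e)) t w"
  proof (cases "i \<in> {1..d} \<and> a \<in> idx n \<and> b \<in> idx n \<and> c \<in> idx n \<and> e \<in> idx n \<and> w \<in> words n d \<and> w ! (i - 1) = a")
    case True
    then have w: "w[i - 1 := b] \<in> words n d" "w[i - 1 := b] ! (i - 1) = b"
      by (auto simp: words_update words_length)
    have "(par a + par b) * l + (par b + par e) * l = (par a + par e) * l" for l
      by (simp add: algebra_simps)
    moreover have "par a + par b + (par b + par e) = par a + par e" by (simp add: add.assoc)
    ultimately show ?thesis
      using True w by (auto simp: apply_endo_delta apply_endo_F unit_fun_def delta_def twist_sg twist_twist prefix_par_update_ge)
  next
    case False
    then show ?thesis by (auto simp: apply_endo_delta apply_endo_F unit_fun_def delta_def)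
  qed
qed

lemma F_unit:
  assumes "i \<in> {1..d}" shows "(\<Sum>a\<in>idx n. F i a a) = P"
proof (rule add_endo_ext)
  fix t w
  show "apply_endo (\<Sum>a\<in>idx n. F i a a) t w = apply_endo P t w"
  proof (cases "w \<in> words n d")
    case True
    have "apply_endo (\<Sum>a\<in>idx n. F i a a) t w = (\<Sum>a\<in>idx n. if a = w ! (i - 1) then t w else 0)"
      using True assms by (simp add: apply_endo_sum sum_apply apply_endo_F unit_fun_def cong: sum.cong)
    then show ?thesis using True words_nth[OF True assms] by (simp add: apply_endo_P)
  next
    case False
    then show ?thesis by (simp add: apply_endo_sum sum_apply apply_endo_F unit_fun_def apply_endo_P)
  qed
qed

text \<open>For \<open>i < j\<close> the operator in factor \<open>i\<close> changes the prefix parity seen by the one in factor \<open>j\<close>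
  by its own parity.\<close>

lemma F_supercomm:
  assumes "i \<noteq> j" shows "supercomm (par a + par b) (F i a b) (par c + par e) (F j c e)"
proof -
  have *: "supercomm (par a + par b) (F i a b) (par c + par e) (F j c e)" if "i < j" for i j a b c e
    unfolding supercomm_def
  proof (rule add_endo_ext)
    fix t w
    let ?s = "(par a + par b) * (par c + par e)"
    show "apply_endo (F i a b * F j c e) t w = apply_endo (sg ?s (F j c e * F i a b)) t w"
    proof (cases "i \<in> {1..d} \<and> j \<in> {1..d} \<and> a \<in> idx n \<and> b \<in> idx n \<and> c \<in> idx n \<and> e \<in> idx n \<and> w \<in> words n d \<and>
        w ! (i - 1) = a \<and> w ! (j - 1) = c")
      case True
      have ij: "i - 1 \<noteq> j - 1" using True that by auto
      have w: "w[i - 1 := b] \<in> words n d" "w[i - 1 := b] ! (j - 1) = c"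
        "w[j - 1 := e] \<in> words n d" "w[j - 1 := e] ! (i - 1) = a"
        using True ij by (auto simp: words_update)
      have l: "prefix_par (w[j - 1 := e]) i = prefix_par w i"
        "prefix_par (w[i - 1 := b]) j = prefix_par w j + par a + par b"
        using True that by (auto simp: prefix_par_update_ge prefix_par_update_less words_length)
      have u: "w[i - 1 := b, j - 1 := e] = w[j - 1 := e, i - 1 := b]"
        using ij by (rule list_update_swap)
      show ?thesis
        using True w l u
        by (simp add: apply_endo_sg sg_apply apply_endo_F unit_fun_def twist_sg twist_twist algebra_simps)
    next
      case False
      have nth: "w[i - 1 := b] ! (j - 1) = w ! (j - 1)" "w[j - 1 := e] ! (i - 1) = w ! (i - 1)"
        if "i \<in> {1..d}" using that \<open>i < j\<close> by auto
      show ?thesis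
        using False nth by (auto simp: apply_endo_sg sg_apply apply_endo_F unit_fun_def)
    qed
  qed
  show ?thesis
    using *[of i j a b c e] supercomm_sym[OF *[of j i c e a b]] assms by (cases "i < j") auto
qed

lemma g_supercomm: "supercomm (par a + par b) (g a b) (par c + par e) (F i c e)"
  unfolding supercomm_def
proof (rule add_endo_ext)
  fix t w
  let ?s = "(par a + par b) * (par c + par e)"
  show "apply_endo (g a b * F i c e) t w = apply_endo (sg ?s (F i c e * g a b)) t w"
  proof (cases "i \<in> {1..d} \<and> a \<in> idx n \<and> b \<in> idx n \<and> c \<in> idx n \<and> e \<in> idx n \<and> w \<in> words n d \<and> w ! (i - 1) = c")
    case True
    then have w: "w[i - 1 := e] \<in> words n d" by (auto simp: words_update)
    show ?thesis
      using True w
      by (simp add: apply_endo_sg sg_apply apply_endo_F apply_endo_g unit_fun_def action_linear q_mat_in_q_alg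
          action_twist[OF q_mat_in_q_part] mult.commute add.commute)
  next
    case False
    then show ?thesis by (auto simp: apply_endo_sg sg_apply apply_endo_F apply_endo_g unit_fun_def action_linear q_mat_in_q_alg)
  qed
qed

lemma g_outside: "a \<notin> idx n \<or> b \<notin> idx n \<Longrightarrow> g a b = 0"
  by (rule add_endo_ext) (auto simp: apply_endo_g)

lemma g_family: "q_family n g"
  unfolding q_family_def
proof (intro conjI allI impI)
  fix a b c e
  show "g (- a) (- b) = g a b"
    by (rule add_endo_ext) (simp add: apply_endo_g q_mat_uminus)
  show "g a b = 0" if "a \<notin> idx n \<or> b \<notin> idx n" using that by (rule g_outside)
  define s where "s = (par a + par b) * (par c + par e)"
  show "g a b * g c e - sg ((par a + par b) * (par c + par e)) (g c e * g a b) =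
        delta n b c (g a e) + delta n b (- c) (g a (- e))
        - sg ((par a + par b) * (par c + par e)) (delta n e a (g c b) + delta n e (- a) (g c (- b)))"
    unfolding s_def[symmetric]
  proof (cases "a \<in> idx n \<and> b \<in> idx n \<and> c \<in> idx n \<and> e \<in> idx n")
    case True
    show "g a b * g c e - sg s (g c e * g a b) =
        delta n b c (g a e) + delta n b (- c) (g a (- e))
        - sg s (delta n e a (g c b) + delta n e (- a) (g c (- b)))"
    proof (rule add_endo_ext)
      fix t w
      show "apply_endo (g a b * g c e - sg s (g c e * g a b)) t w =
        apply_endo (delta n b c (g a e) + delta n b (- c) (g a (- e))
        - sg s (delta n e a (g c b) + delta n e (- a) (g c (- b)))) t w"
      proof (cases "w \<in> words n d")
        case w: True
        show ?thesis
          using True w action_q_mat_bracket[of a b c e "t w"]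
          by (simp add: apply_endo_sg sg_apply apply_endo_delta apply_endo_g s_def)
      next
        case False
        then show ?thesis by (simp add: apply_endo_sg sg_apply apply_endo_delta apply_endo_g)
      qed
    qed
  next
    case False
    then consider "a \<notin> idx n" | "b \<notin> idx n" | "c \<notin> idx n" | "e \<notin> idx n" by blast
    then show "g a b * g c e - sg s (g c e * g a b) =
        delta n b c (g a e) + delta n b (- c) (g a (- e))
        - sg s (delta n e a (g c b) + delta n e (- a) (g c (- b)))"
      by cases (simp_all add: g_outside delta_outside)
  qed
qed

end

sublocale q_tensor \<subseteq> sergeev_operators n d P F g
  by (rule sergeev_operators.intro)
    (fact F_outside F_mult F_unit F_supercomm g_family g_supercomm)+

section \<open>Comparison with the operators of the theorem\<close>

lemma par_idx_pos: "a \<in> idx_pos n \<Longrightarrow> par a = 0" "a \<in> idx_pos n \<Longrightarrow> par (- a) = 1"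
  by (auto simp: idx_pos_def par_def)

lemma words_update_cancel:
  assumes "w[i := b] \<in> words n d" "w ! i \<in> idx n" shows "w \<in> words n d"
  using words_update[OF assms(1,2), of i] by simp

context q_tensor
begin

lemma tensorsI: "(\<And>w. w \<notin> words n d \<Longrightarrow> t w = 0) \<Longrightarrow> t \<in> tensors n d"
  by (simp add: tensors_def)

lemma apply_endo_F_tensors: "apply_endo (F i a b) t \<in> tensors n d"
  by (rule tensorsI) (simp add: apply_endo_F unit_fun_def)

lemma apply_endo_g_tensors: "apply_endo (g a b) t \<in> tensors n d"
  by (rule tensorsI) (simp add: apply_endo_g)

lemma factor_op_eq:
  "factor_op sc M n i A t w = (\<Sum>b\<in>idx n. sc (A (w ! (i - 1)) b)
     (sg ((par (w ! (i - 1)) + par b) * prefix_par w i) (twist (par (w ! (i - 1)) + par b) (t (w[i - 1 := b])))))"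
proof -
  have "(\<Sum>q\<in>{0, 1}. sc (ssign (p * (q + l)) * c) (component M q m)) = sc c (sg (p * l) (twist p m))"
    for p l c m
    by (simp add: sc_ssign_mult twist_def sg_add distrib_left scale_right_distrib sc_sg add.commute)
  then show ?thesis unfolding factor_op_def prefix_par_def by simp
qed

text \<open>The agreement includes words \<open>w\<close> outside the tensor space: if \<open>E\<^bsub>ab\<^esub>\<close> has a nonzero entry there, then
  the letter at position \<open>i\<close> is the valid letter \<open>a\<close>, so the defect of \<open>w\<close> lies elsewhere, survives the
  update at \<open>i\<close>, and makes \<open>t\<close> vanish.\<close>

lemma factor_op_E:
  assumes "t \<in> tensors n d" "a \<in> idx n" "b \<in> idx n" "i \<in> {1..d}"
  shows "factor_op sc M n i (E a b) t = apply_endo (F i a b) t"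
proof
  fix w
  have "factor_op sc M n i (E a b) t w = (\<Sum>c\<in>idx n. if c = b then
      if w ! (i - 1) = a then sg ((par a + par b) * prefix_par w i) (twist (par a + par b) (t (w[i - 1 := b]))) else 0 else 0)"
    unfolding factor_op_eq by (rule sum.cong) (auto simp: E_def)
  also have "\<dots> = (if w ! (i - 1) = a then sg ((par a + par b) * prefix_par w i) (twist (par a + par b) (t (w[i - 1 := b]))) else 0)"
    using assms by simp
  also have "\<dots> = apply_endo (F i a b) t w"
  proof (cases "w \<in> words n d")
    case False
    have "t (w[i - 1 := b]) = 0" if "w ! (i - 1) = a"
      using words_update_cancel[of w "i - 1" b n d] False that assms by (auto simp: tensors_def)
    then show ?thesis using False by (simp add: apply_endo_F unit_fun_def)
  qed (use assms in \<open>auto simp: apply_endo_F unit_fun_def\<close>)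
  finally show "factor_op sc M n i (E a b) t w = apply_endo (F i a b) t w" .
qed

lemma factor_op_add:
  "factor_op sc M n i (\<lambda>a b. A a b + B a b) t w = factor_op sc M n i A t w + factor_op sc M n i B t w"
  by (simp add: factor_op_eq scale_left_distrib sum.distrib)

lemma factor_op_diff:
  "factor_op sc M n i (\<lambda>a b. A a b - B a b) t w = factor_op sc M n i A t w - factor_op sc M n i B t w"
  by (simp add: factor_op_eq scale_left_diff_distrib sum_subtractf)

lemma factor_op_scale:
  "factor_op sc M n i (\<lambda>a b. c * A a b) t w = sc c (factor_op sc M n i A t w)"
  by (simp add: factor_op_eq scale_sum_right)

lemma factor_op_sum:
  "factor_op sc M n i (\<lambda>a b. \<Sum>k\<in>K. A k a b) t w = (\<Sum>k\<in>K. factor_op sc M n i (A k) t w)"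
  by (simp add: factor_op_eq scale_sum_left sum.swap[of _ K])

lemma factor_op_q_mat:
  assumes "t \<in> tensors n d" "a \<in> idx n" "b \<in> idx n" "i \<in> {1..d}"
  shows "factor_op sc M n i (q_mat a b) t w = apply_endo (Q i a b) t w"
  using assms by (simp add: q_mat_def factor_op_add factor_op_E Q_def)

lemma C_op_eq:
  assumes "t \<in> tensors n d" "i \<in> {1..d}" shows "C_op sc n M i t = apply_endo (C i) t"
proof
  fix w
  have "C_op sc n M i t w = (\<Sum>k\<in>idx_pos n. apply_endo (F i (- k) k) t w - apply_endo (F i k (- k)) t w)"
    unfolding C_op_def C_mat_def fbar_mat_def
    using assms by (simp add: factor_op_sum factor_op_diff factor_op_E idx_pos_idx)
  also have "\<dots> = apply_endo (C i) t w"
    by (simp add: C_def apply_endo_sum sum_apply sum_idx_idx_pos apply_endo_sg sg_apply par_idx_pos)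
  finally show "C_op sc n M i t w = apply_endo (C i) t w" .
qed

lemma sc_sgn: "b \<in> idx n \<Longrightarrow> sc (complex_of_int (sgn b)) m = sg (par b) m"
  by (auto simp: idx_def par_def sg_def)

lemma S_op_eq:
  assumes "t \<in> tensors n d" "i \<in> {1..d}" "j \<in> {1..d}" shows "S_op sc n M i j t = apply_endo (S i j) t"
  using assms
  by (intro ext) (simp add: S_op_def S_def apply_endo_sum sum_apply apply_endo_sg sg_apply sc_sgn factor_op_E apply_endo_F_tensors)

lemma apply_endo_S_tensors: "apply_endo (S i j) t \<in> tensors n d"
  using apply_endo_F_tensors
  by (intro tensorsI) (simp add: S_def apply_endo_sum sum_apply apply_endo_sg sg_apply tensors_def)

lemma apply_endo_C_tensors: "apply_endo (C i) t \<in> tensors n d"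
  using apply_endo_F_tensors
  by (intro tensorsI) (simp add: C_def apply_endo_sum sum_apply apply_endo_sg sg_apply tensors_def)

lemma factor0_op_q_mat:
  assumes "t \<in> tensors n d" "a \<in> idx n" "b \<in> idx n"
  shows "factor0_op \<rho> (q_mat a b) t w = apply_endo (g a b) t w"
  using assms by (simp add: factor0_op_def apply_endo_g tensors_def action_linear q_mat_in_q_alg)

lemma g_uminus: "g (- a) (- b) = g a b" "g (- a) b = g a (- b)"
  using g_family unfolding q_family_def by (metis minus_minus)+

text \<open>Splitting each sum over \<open>I\<close> into positive and negative indices turns \<open>\<Sum> sgn(b) q\<^bsub>ab\<^esub> \<otimes> E\<^bsub>ba\<^esub>\<close>
  into the sum of \<open>e\<^bsub>ab\<^esub> \<otimes> (E\<^bsub>ba\<^esub> - E\<^bsub>-b,-a\<^esub>)\<close> and \<open>f\<^bsub>ab\<^esub> \<otimes> (E\<^bsub>b,-a\<^esub> - E\<^bsub>-b,a\<^esub>)\<close>.\<close>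

lemma Omega_op_eq:
  assumes t: "t \<in> tensors n d" and i: "i \<in> {1..d}"
  shows "Omega_op sc n M \<rho> i t = apply_endo (\<Sum>a\<in>idx n. \<Sum>b\<in>idx n. sg (par b) (g a b * F i b a)) t"
proof
  fix w
  let ?G = "\<lambda>a b c e. apply_endo (g a b) (apply_endo (F i c e) t) w"
  have idx: "a \<in> idx n" if "a \<in> idx_pos n" for a using that by (rule idx_pos_idx)
  have ebar: "factor_op sc M n i (ebar_mat b a) t = apply_endo (F i b a) t - apply_endo (F i (- b) (- a)) t"
    and fbar: "factor_op sc M n i (fbar_mat b a) t = apply_endo (F i (- b) a) t - apply_endo (F i b (- a)) t"
    if "a \<in> idx_pos n" "b \<in> idx_pos n" for a b
    using that t i by (auto simp: fun_eq_iff ebar_mat_def fbar_mat_def factor_op_diff factor_op_E idx)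
  have mem: "apply_endo (F i a b) t - apply_endo (F i c e) t \<in> tensors n d" for a b c e
    using apply_endo_F_tensors by (auto simp: tensors_def)
  have 1: "factor0_op \<rho> (e_mat a b) (factor_op sc M n i (ebar_mat b a) t) w
      - factor0_op \<rho> (f_mat a b) (factor_op sc M n i (fbar_mat b a) t) w
      = ?G a b b a - ?G a b (- b) (- a) - ?G (- a) b (- b) a + ?G (- a) b b (- a)"
    if "a \<in> idx_pos n" "b \<in> idx_pos n" for a b
    by (simp add: e_mat_q_mat f_mat_q_mat ebar fbar that idx factor0_op_q_mat mem
        apply_endo_diff algebra_simps)
  have "Omega_op sc n M \<rho> i t w = (\<Sum>a\<in>idx_pos n. \<Sum>b\<in>idx_pos n.
      ?G a b b a - ?G a b (- b) (- a) - ?G (- a) b (- b) a + ?G (- a) b b (- a))"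
    unfolding Omega_op_def sum_subtractf[symmetric] by (intro sum.cong refl 1)
  also have "\<dots> = (\<Sum>a\<in>idx_pos n. \<Sum>b\<in>idx_pos n.
      (?G a b b a - ?G a (- b) (- b) a) + (?G (- a) b b (- a) - ?G (- a) (- b) (- b) (- a)))"
    by (intro sum.cong refl) (simp add: g_uminus)
  also have "\<dots> = apply_endo (\<Sum>a\<in>idx n. \<Sum>b\<in>idx n. sg (par b) (g a b * F i b a)) t w"
    by (simp add: apply_endo_sum sum_apply sum_idx_idx_pos apply_endo_sg sg_apply par_idx_pos sum.distrib)
  finally show "Omega_op sc n M \<rho> i t w = apply_endo (\<Sum>a\<in>idx n. \<Sum>b\<in>idx n. sg (par b) (g a b * F i b a)) t w" .
qed

text \<open>Each summand \<open>Q j\<close> of \<open>D (i - 1)\<close> contributes an \<open>\<Omega>\<close> between two copies of \<open>V\<close>.\<close>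

lemma X_eq:
  assumes "i \<ge> 1"
  shows "X i = (\<Sum>a\<in>idx n. \<Sum>b\<in>idx n. sg (par b) (g a b * F i b a))
    + (\<Sum>j\<in>{1..<i}. S j i - C j * (C i * S j i))"
proof -
  have i: "{1..i - 1} = {1..<i}" using assms by auto
  have "X i = (\<Sum>a\<in>idx n. \<Sum>b\<in>idx n. sg (par b) (g a b * F i b a))
      + (\<Sum>a\<in>idx n. \<Sum>b\<in>idx n. \<Sum>j\<in>{1..<i}. sg (par b) (Q j a b * F i b a))"
    unfolding X_def D_def i by (simp add: distrib_right sg_add sum.distrib sum_distrib_right sg_sum)
  also have "(\<Sum>a\<in>idx n. \<Sum>b\<in>idx n. \<Sum>j\<in>{1..<i}. sg (par b) (Q j a b * F i b a)) =
      (\<Sum>j\<in>{1..<i}. \<Sum>a\<in>idx n. \<Sum>b\<in>idx n. sg (par b) (Q j a b * F i b a))"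
    by (simp only: sum.swap[of _ "{1..<i}"])
  also have "\<dots> = (\<Sum>j\<in>{1..<i}. S j i - C j * (C i * S j i))"
    by (intro sum.cong refl Omega_on_V) auto
  finally show ?thesis .
qed

lemma X_op_eq:
  assumes t: "t \<in> tensors n d" and i: "i \<in> {1..d}"
  shows "X_op sc n M \<rho> i t = apply_endo (X i) t"
proof
  fix w
  have "S_op sc n M j i t w - C_op sc n M j (C_op sc n M i (S_op sc n M j i t)) w
      = apply_endo (S j i - C j * (C i * S j i)) t w" if "j \<in> {1..<i}" for j
    using that i by (simp add: S_op_eq[OF t] C_op_eq apply_endo_S_tensors apply_endo_C_tensors)
  then show "X_op sc n M \<rho> i t w = apply_endo (X i) t w"
    using i by (simp add: X_op_def Omega_op_eq[OF t i] X_eq apply_endo_sum sum_apply)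
qed

lemma action_sum:
  assumes "\<And>k. k \<in> A \<Longrightarrow> y k \<in> q_part n p"
  shows "\<rho> (\<lambda>a b. \<Sum>k\<in>A. y k a b) m = (\<Sum>k\<in>A. \<rho> (y k) m) \<and> (\<lambda>a b. \<Sum>k\<in>A. y k a b) \<in> q_part n p"
  using assms
proof (induction A rule: infinite_finite_induct)
  case (insert k A)
  then have y: "y k \<in> q_part n p" "(\<lambda>a b. \<Sum>k\<in>A. y k a b) \<in> q_part n p" by auto
  have "\<rho> (\<lambda>a b. y k a b + (\<Sum>k\<in>A. y k a b)) m = \<rho> (y k) m + \<rho> (\<lambda>a b. \<Sum>k\<in>A. y k a b) m"
    by (rule action_add[OF y[THEN q_part_q_alg]])
  then show ?case
    using insert q_part_add[OF y] by simp
qed (use action_scale[OF q_part_q_alg[OF zero_in_q_part], of 0] zero_in_q_part in auto)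

lemma tensor_action_q_mat:
  assumes "t \<in> tensors n d" "a \<in> idx n" "b \<in> idx n"
  shows "tensor_action sc n M \<rho> d (q_mat a b) t = apply_endo (D d a b) t"
  using assms
  by (intro ext) (simp add: tensor_action_def D_def factor0_op_q_mat factor_op_q_mat apply_endo_sum sum_apply)

lemma tensor_action_sum:
  assumes "\<And>k. k \<in> A \<Longrightarrow> y k \<in> q_part n p"
  shows "tensor_action sc n M \<rho> d (\<lambda>a b. \<Sum>k\<in>A. y k a b) t w = (\<Sum>k\<in>A. tensor_action sc n M \<rho> d (y k) t w)"
proof -
  have "\<rho> (\<lambda>a b. \<Sum>k\<in>A. y k a b) (t w) = (\<Sum>k\<in>A. \<rho> (y k) (t w))"
    by (rule conjunct1[OF action_sum]) (rule assms)
  then show ?thesis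
    by (simp add: tensor_action_def factor0_op_def factor_op_sum sum.distrib sum.swap[of _ A])
qed

lemma tensor_action_scale:
  assumes "y \<in> q_part n p"
  shows "tensor_action sc n M \<rho> d (\<lambda>a b. c * y a b) t w = sc c (tensor_action sc n M \<rho> d y t w)"
  by (simp add: tensor_action_def factor0_op_def factor_op_scale scale_right_distrib scale_sum_right
      action_scale[OF q_part_q_alg[OF assms]])

text \<open>The coefficients do not depend on \<open>t\<close>. Hence operators that supercommute with all \<open>D d a b\<close>
  and are linear supercommute with all of \<open>q(n)\<close>.\<close>

lemma tensor_action_eq:
  assumes "x \<in> q_part n r"
  shows "\<exists>\<alpha>. \<forall>t\<in>tensors n d. tensor_action sc n M \<rho> d x t =
    (\<lambda>w. \<Sum>i\<in>idx_pos n. \<Sum>j\<in>idx_pos n. sc (\<alpha> i j) (apply_endo (D d (if r = 0 then i else - i) j) t w))"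
proof -
  let ?q = "\<lambda>i j. if r = 0 then e_mat i j else f_mat i j"
  obtain \<alpha> where x: "x = (\<lambda>a b. \<Sum>i\<in>idx_pos n. \<Sum>j\<in>idx_pos n. \<alpha> i j * ?q i j a b)"
    by (rule q_partE[OF assms])
  have q: "?q i j = q_mat (if r = 0 then i else - i) j" for i j
    by (simp add: e_mat_q_mat f_mat_q_mat)
  have 1: "?q i j \<in> q_part n r" "(\<lambda>a b. \<alpha> i j * ?q i j a b) \<in> q_part n r"
    if "i \<in> idx_pos n" "j \<in> idx_pos n" for i j
    by (rule e_f_mat_in_q_part[OF that], rule q_part_scale[OF e_f_mat_in_q_part[OF that]])
  have 2: "(\<lambda>a b. \<Sum>j\<in>idx_pos n. \<alpha> i j * ?q i j a b) \<in> q_part n r" if "i \<in> idx_pos n" for i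
    by (rule conjunct2[OF action_sum]) (rule 1[OF that])
  have "tensor_action sc n M \<rho> d x t =
    (\<lambda>w. \<Sum>i\<in>idx_pos n. \<Sum>j\<in>idx_pos n. sc (\<alpha> i j) (apply_endo (D d (if r = 0 then i else - i) j) t w))"
    if t: "t \<in> tensors n d" for t
  proof
    fix w
    have "tensor_action sc n M \<rho> d x t w =
        (\<Sum>i\<in>idx_pos n. tensor_action sc n M \<rho> d (\<lambda>a b. \<Sum>j\<in>idx_pos n. \<alpha> i j * ?q i j a b) t w)"
      unfolding x by (rule tensor_action_sum[OF 2])
    also have "\<dots> = (\<Sum>i\<in>idx_pos n. \<Sum>j\<in>idx_pos n. tensor_action sc n M \<rho> d (\<lambda>a b. \<alpha> i j * ?q i j a b) t w)"
      by (intro sum.cong refl tensor_action_sum[OF 1(2)])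
    also have "\<dots> = (\<Sum>i\<in>idx_pos n. \<Sum>j\<in>idx_pos n. sc (\<alpha> i j) (tensor_action sc n M \<rho> d (?q i j) t w))"
      by (intro sum.cong refl tensor_action_scale[OF 1(1)])
    also have "\<dots> = (\<Sum>i\<in>idx_pos n. \<Sum>j\<in>idx_pos n. sc (\<alpha> i j) (apply_endo (D d (if r = 0 then i else - i) j) t w))"
      by (intro sum.cong refl) (simp add: q tensor_action_q_mat t idx_pos_idx del: if_split)
    finally show "tensor_action sc n M \<rho> d x t w = \<dots>" .
  qed
  then show ?thesis by (intro exI ballI)
qed

section \<open>Endomorphisms commuting with q(n)\<close>

definition K :: "complex \<Rightarrow> 'm tensor add_endo" where
  "K c = Add_endo (\<lambda>t w. sc c (t w))"

lemma apply_endo_K: "apply_endo (K c) t w = sc c (t w)"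
  unfolding K_def by (subst Add_endo_inverse) (auto simp: fun_eq_iff scale_right_distrib)

text \<open>Complex-linear operators of parity \<open>p\<close> that preserve the tensor space. Linearity is required on
  all coefficient functions, as a commutation in the ring.\<close>

definition lin_op :: "bit \<Rightarrow> 'm tensor add_endo \<Rightarrow> bool" where
  "lin_op p T \<longleftrightarrow> (\<forall>t\<in>tensors n d. apply_endo T t \<in> tensors n d) \<and> (\<forall>c. T * K c = K c * T) \<and>
     (\<forall>q. \<forall>t\<in>tensors_gr n d M q. apply_endo T t \<in> tensors_gr n d M (p + q))"

lemma tensors_gr_tensors: "t \<in> tensors_gr n d M q \<Longrightarrow> t \<in> tensors n d"
  by (simp add: tensors_gr_def)

lemma lin_opI:
  assumes "\<And>t. apply_endo T t \<in> tensors n d" "\<And>c t w. apply_endo T (\<lambda>w. sc c (t w)) w = sc c (apply_endo T t w)"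
    "\<And>q t w. t \<in> tensors_gr n d M q \<Longrightarrow> w \<in> words n d \<Longrightarrow> apply_endo T t w \<in> M (p + q + sum_list (map par w))"
  shows "lin_op p T"
proof -
  have "T * K c = K c * T" for c
  proof (rule add_endo_ext)
    fix t w
    have "apply_endo (K c) t = (\<lambda>w. sc c (t w))" by (rule ext) (rule apply_endo_K)
    then show "apply_endo (T * K c) t w = apply_endo (K c * T) t w"
      using assms(2) by (simp add: apply_endo_K)
  qed
  then show ?thesis unfolding lin_op_def using assms(1,3) by (auto simp: tensors_gr_def)
qed

lemma zero_in_part [simp]: "0 \<in> M p"
  using subspace_part subspace_0 by blast

lemma lin_op_F: "lin_op (par a + par b) (F i a b)"
proof (rule lin_opI)
  show "apply_endo (F i a b) t \<in> tensors n d" for t by (rule apply_endo_F_tensors)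
  show "apply_endo (F i a b) (\<lambda>w. sc c (t w)) w = sc c (apply_endo (F i a b) t w)" for c t w
    by (simp add: apply_endo_F unit_fun_def twist_scale sc_sg)
  fix q t w assume t: "t \<in> tensors_gr n d M q" "w \<in> words n d"
  show "apply_endo (F i a b) t w \<in> M (par a + par b + q + sum_list (map par w))"
  proof (cases "i \<in> {1..d} \<and> a \<in> idx n \<and> b \<in> idx n \<and> w ! (i - 1) = a")
    case True
    have "t (w[i - 1 := b]) \<in> M (q + sum_list (map par (w[i - 1 := b])))"
      using t True words_update[of w n d b] by (simp add: tensors_gr_def)
    also have "sum_list (map par (w[i - 1 := b])) = sum_list (map par w) + par a + par b"
      using True words_length[OF t(2)] by (subst sum_list_update_par) auto
    finally show ?thesis using True t
      by (simp add: apply_endo_F unit_fun_def twist_in_part sg_in_part algebra_simps)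
  qed (auto simp: apply_endo_F unit_fun_def)
qed

lemma lin_op_g: "lin_op (par a + par b) (g a b)"
proof (rule lin_opI)
  show "apply_endo (g a b) t \<in> tensors n d" for t by (rule apply_endo_g_tensors)
  show "apply_endo (g a b) (\<lambda>w. sc c (t w)) w = sc c (apply_endo (g a b) t w)" for c t w
    by (simp add: apply_endo_g action_linear q_mat_in_q_alg)
  fix q t w assume t: "t \<in> tensors_gr n d M q" "w \<in> words n d"
  then have "t w \<in> M (q + sum_list (map par w))" by (simp add: tensors_gr_def)
  then show "apply_endo (g a b) t w \<in> M (par a + par b + q + sum_list (map par w))"
    using action_parity[OF q_mat_in_q_part] by (auto simp: apply_endo_g add.assoc)
qed

lemma lin_op_zero: "lin_op p 0"
  by (rule lin_opI) (simp_all add: tensors_def)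

lemma tensors_gr_add: "t \<in> tensors_gr n d M q \<Longrightarrow> u \<in> tensors_gr n d M q \<Longrightarrow> t + u \<in> tensors_gr n d M q"
  using subspace_part subspace_add by (auto simp: tensors_gr_def tensors_def)

lemma tensors_add: "t \<in> tensors n d \<Longrightarrow> u \<in> tensors n d \<Longrightarrow> t + u \<in> tensors n d"
  by (auto simp: tensors_def)

lemma lin_op_add: "lin_op p U \<Longrightarrow> lin_op p T \<Longrightarrow> lin_op p (U + T)"
  by (simp add: lin_op_def tensors_add tensors_gr_add algebra_simps)

lemma lin_op_uminus: "lin_op p T \<Longrightarrow> lin_op p (- T)"
  using subspace_part subspace_neg by (auto simp: lin_op_def tensors_gr_def tensors_def)

lemma lin_op_sg: "lin_op p T \<Longrightarrow> lin_op p (sg q T)"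
  by (simp add: sg_def lin_op_uminus)

lemma lin_op_sum: "(\<And>a. a \<in> A \<Longrightarrow> lin_op p (f a)) \<Longrightarrow> lin_op p (sum f A)"
  by (induction A rule: infinite_finite_induct) (simp_all add: lin_op_zero lin_op_add)

lemma lin_op_mult:
  assumes "lin_op p U" "lin_op q T" shows "lin_op (p + q) (U * T)"
proof -
  have "U * T * K c = K c * (U * T)" for c
  proof -
    have "U * T * K c = U * (T * K c)" by (simp only: mult.assoc)
    also have "\<dots> = U * K c * T" using assms(2) by (simp add: lin_op_def mult.assoc)
    also have "\<dots> = K c * (U * T)" using assms(1) by (simp add: lin_op_def mult.assoc)
    finally show ?thesis .
  qed
  then show ?thesis using assms by (simp add: lin_op_def add.assoc)
qed

lemma lin_op_even: "lin_op (par a + par b) U \<Longrightarrow> lin_op (par b + par a) T \<Longrightarrow> lin_op 0 (U * T)"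
  using lin_op_mult[of "par a + par b" U "par b + par a" T] by (simp add: add.assoc)

lemma lin_op_Q: "lin_op (par a + par b) (Q i a b)"
proof (cases "a \<in> idx n \<and> b \<in> idx n")
  case True
  then have "par (- a) + par (- b) = par a + par b"
    by (simp add: par_add_uminus[where n = n])
  then show ?thesis
    unfolding Q_def using lin_op_F[of a b i] lin_op_F[of "- a" "- b" i] by (auto intro: lin_op_add)
next
  case False
  then show ?thesis by (simp add: Q_outside lin_op_zero)
qed

lemma lin_op_D: "lin_op (par a + par b) (D k a b)"
  unfolding D_def by (intro lin_op_add lin_op_sum lin_op_g lin_op_Q)

lemma lin_op_C: "lin_op 1 (C i)"
  unfolding C_def
proof (intro lin_op_sum lin_op_sg)
  fix a assume "a \<in> idx n"
  then show "lin_op 1 (F i (- a) a)"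
    using lin_op_F[of "- a" a i] by (simp add: par_uminus add.commute[of _ 1] add.assoc)
qed

lemma lin_op_S: "lin_op 0 (S i j)"
  unfolding S_def by (intro lin_op_sum lin_op_sg lin_op_even[OF lin_op_F lin_op_F])

lemma lin_op_X: "lin_op 0 (X i)"
  unfolding X_def by (intro lin_op_sum lin_op_sg lin_op_even[OF lin_op_D lin_op_F])

definition q_op :: "bit \<Rightarrow> 'm tensor add_endo \<Rightarrow> bool" where
  "q_op p T \<longleftrightarrow> lin_op p T \<and> (\<forall>a b. supercomm p T (par a + par b) (D d a b))"

lemma q_op_C: "q_op 1 (C i)"
  by (simp add: q_op_def lin_op_C C_supercomm_D)

lemma q_op_S: "i \<in> {1..<d} \<Longrightarrow> q_op 0 (S i (i + 1))"
  unfolding q_op_def using lin_op_S S_supercomm_D[of d i] by auto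

lemma q_op_X: "i \<in> {1..d} \<Longrightarrow> q_op 0 (X i)"
  unfolding q_op_def using lin_op_X X_supercomm_D[of i d] by auto

lemma q_op_one: "q_op 0 1"
  by (simp add: q_op_def lin_op_def supercomm_def)

lemma q_op_mult:
  assumes "q_op p U" "q_op q T" shows "q_op (p + q) (U * T)"
  unfolding q_op_def
proof (intro conjI allI)
  show "lin_op (p + q) (U * T)" using assms by (simp add: q_op_def lin_op_mult)
  fix a b
  show "supercomm (p + q) (U * T) (par a + par b) (D d a b)"
    using assms by (intro supercomm_sym[OF supercomm_mult]) (auto simp: q_op_def intro: supercomm_sym)
qed

lemma q_op_sum:
  assumes "\<And>a. a \<in> A \<Longrightarrow> q_op p (f a)" shows "q_op p (sum f A)"
  unfolding q_op_def
proof (intro conjI allI)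
  show "lin_op p (sum f A)" using assms by (intro lin_op_sum) (simp add: q_op_def)
  fix a b
  show "supercomm p (sum f A) (par a + par b) (D d a b)"
    using assms by (intro supercomm_sym[OF supercomm_sum]) (auto simp: q_op_def intro: supercomm_sym)
qed

lemma q_op_K: "q_op 0 (K c)"
proof -
  have K: "apply_endo (K c) t = (\<lambda>w. sc c (t w))" for t by (rule ext) (rule apply_endo_K)
  have "K c * K e = K e * K c" for e
    by (rule add_endo_ext) (simp add: apply_endo_K mult.commute)
  then have "lin_op 0 (K c)"
    using subspace_part subspace_scale by (auto simp: lin_op_def tensors_def tensors_gr_def K)
  then show ?thesis
    using lin_op_D unfolding q_op_def lin_op_def supercomm_def by simp
qed

text \<open>The action of a homogeneous element of \<open>q(n)\<close> is a combination \<open>?Y\<close> of the \<open>D d a b\<close> with scalar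
  coefficients, so that supercommutation passes from the family \<open>D d\<close> to it.\<close>

lemma q_op_q_end_gr:
  assumes "q_op p T" shows "restrict (apply_endo T) (tensors n d) \<in> q_end_gr sc n M \<rho> d p"
proof -
  have lin: "lin_op p T" and com: "supercomm p T (par a + par b) (D d a b)" for a b
    using assms by (simp_all add: q_op_def)
  have Tt: "apply_endo T t \<in> tensors n d" if "t \<in> tensors n d" for t
    using lin that by (simp add: lin_op_def)
  have scale: "apply_endo T (\<lambda>w. sc c (t w)) = (\<lambda>w. sc c (apply_endo T t w))" for c t
  proof -
    have K: "apply_endo (K c) t = (\<lambda>w. sc c (t w))" for t by (rule ext) (rule apply_endo_K)
    have "apply_endo (T * K c) t = apply_endo (K c * T) t" using lin by (simp add: lin_op_def)
    then show ?thesis by (simp add: K)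
  qed
  have add_mem: "(\<lambda>w. t w + u w) \<in> tensors n d" if "t \<in> tensors n d" "u \<in> tensors n d" for t u
    using that by (simp add: tensors_def)
  have scale_mem: "(\<lambda>w. sc c (t w)) \<in> tensors n d" if "t \<in> tensors n d" for c t
    using that by (simp add: tensors_def)
  have add: "apply_endo T (\<lambda>w. t w + u w) = (\<lambda>w. apply_endo T t w + apply_endo T u w)" for t u
    using apply_endo_add[of T t u] by (simp add: plus_fun_def)
  have "apply_endo T (tensor_action sc n M \<rho> d x t) = (\<lambda>w. sc (ssign (p * r)) (tensor_action sc n M \<rho> d x (apply_endo T t) w))
      \<and> tensor_action sc n M \<rho> d x t \<in> tensors n d"
    if x: "x \<in> q_part n r" and t: "t \<in> tensors n d" for r x t
  proof -
    from tensor_action_eq[OF x] obtain \<alpha> where \<alpha>: "\<forall>t\<in>tensors n d. tensor_action sc n M \<rho> d x t =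
      (\<lambda>w. \<Sum>i\<in>idx_pos n. \<Sum>j\<in>idx_pos n. sc (\<alpha> i j) (apply_endo (D d (if r = 0 then i else - i) j) t w))"
      by (elim exE)
    let ?Y = "\<Sum>i\<in>idx_pos n. \<Sum>j\<in>idx_pos n. K (\<alpha> i j) * D d (if r = 0 then i else - i) j"
    have Y: "tensor_action sc n M \<rho> d x t = apply_endo ?Y t" if "t \<in> tensors n d" for t
      unfolding bspec[OF \<alpha> that] by (rule ext) (simp add: apply_endo_sum sum_apply apply_endo_K)
    have "supercomm p T r (K c * D d (if r = 0 then i else - i) j)" if "i \<in> idx_pos n" "j \<in> idx_pos n" for c i j
    proof -
      have par: "par (if r = 0 then i else - i) + par j = r" using that by (cases r) (simp_all add: par_idx_pos)
      have "supercomm p T 0 (K c)" using lin by (simp add: lin_op_def supercomm_def)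
      moreover have "supercomm p T r (D d (if r = 0 then i else - i) j)" using com par by metis
      ultimately show ?thesis using supercomm_mult[of p T 0 "K c" r] by simp
    qed
    then have "supercomm p T r ?Y" by (intro supercomm_sum) auto
    then have "apply_endo (T * ?Y) t = apply_endo (sg (p * r) (?Y * T)) t" by (simp add: supercomm_def)
    moreover have "apply_endo ?Y t \<in> tensors n d"
    proof -
      have "lin_op (par a + par b) (K c * D d a b)" for a b c
        using lin_op_mult[of 0 "K c"] lin_op_D q_op_K by (simp add: q_op_def)
      then have "apply_endo (K c * D d a b) t \<in> tensors n d" for a b c
        using t unfolding lin_op_def by blast
      then show ?thesis by (simp add: tensors_def apply_endo_sum sum_apply)
    qed
    ultimately show ?thesis
      by (simp add: Y t Tt apply_endo_sg sg_apply sc_ssign fun_eq_iff del: sum_constant)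
  qed
  then show ?thesis
    using lin tensors_gr_tensors
    by (auto simp: q_end_gr_def Tt add_mem scale_mem add scale lin_op_def)
qed

end

section \<open>The free algebra and its quotient\<close>

lemma free_alg_simps [simp]:
  "mult (free_alg d) = (*)" "one (free_alg d) = 1" "zero (free_alg d) = 0" "add (free_alg d) = (+)"
  by (simp_all add: free_alg_def)

lemma carrier_free_alg: "f \<in> carrier (free_alg d) \<longleftrightarrow> (\<forall>w\<in>Poly_Mapping.keys f. set w \<subseteq> hgens d)"
  by (simp add: free_alg_def)

lemma single_in_free_alg: "set w \<subseteq> hgens d \<Longrightarrow> Poly_Mapping.single w c \<in> carrier (free_alg d)"
  by (simp add: carrier_free_alg)

lemma free_alg_closed:
  assumes "f \<in> carrier (free_alg d)" "h \<in> carrier (free_alg d)"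
  shows "f + h \<in> carrier (free_alg d)" "f * h \<in> carrier (free_alg d)"
proof -
  interpret ring "free_alg d" by (rule ring_free_alg)
  show "f + h \<in> carrier (free_alg d)" "f * h \<in> carrier (free_alg d)"
    using a_closed[OF assms] m_closed[OF assms] by simp_all
qed

lemma one_in_free_alg: "1 \<in> carrier (free_alg d)"
  by (simp add: carrier_free_alg zero_list_def)

lemma sum_single_keys: "(\<Sum>w\<in>Poly_Mapping.keys f. Poly_Mapping.single w (Poly_Mapping.lookup f w)) = f"
proof (rule poly_mapping_eqI)
  fix k
  have "Poly_Mapping.lookup (\<Sum>w\<in>Poly_Mapping.keys f. Poly_Mapping.single w (Poly_Mapping.lookup f w)) k =
      (\<Sum>w\<in>Poly_Mapping.keys f. if w = k then Poly_Mapping.lookup f w else 0)"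
    by (simp add: lookup_sum lookup_single when_def)
  then show "Poly_Mapping.lookup (\<Sum>w\<in>Poly_Mapping.keys f. Poly_Mapping.single w (Poly_Mapping.lookup f w)) k =
      Poly_Mapping.lookup f k"
    by (simp add: in_keys_iff)
qed

lemma free_alg_induct [consumes 1, case_names zero add]:
  assumes f: "f \<in> carrier (free_alg d)" and zero: "R 0"
    and add: "\<And>w c h. set w \<subseteq> hgens d \<Longrightarrow> h \<in> carrier (free_alg d) \<Longrightarrow> R h \<Longrightarrow> R (Poly_Mapping.single w c + h)"
  shows "R f"
proof -
  have "R (\<Sum>w\<in>A. Poly_Mapping.single w (Poly_Mapping.lookup f w)) \<and>
      (\<Sum>w\<in>A. Poly_Mapping.single w (Poly_Mapping.lookup f w)) \<in> carrier (free_alg d)"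
    if "finite A" "A \<subseteq> Poly_Mapping.keys f" for A
    using that
  proof (induction A)
    case empty
    then show ?case using zero by (simp add: carrier_free_alg)
  next
    case (insert w A)
    then have "set w \<subseteq> hgens d" using f by (auto simp: carrier_free_alg)
    then show ?case using insert add by (simp add: free_alg_closed single_in_free_alg)
  qed
  from this[OF finite_keys order_refl] show ?thesis unfolding sum_single_keys ..
qed

lemma carrier_hecke_clifford: "carrier (hecke_clifford d) = hc_class d ` carrier (free_alg d)"
  by (auto simp: hecke_clifford_def Let_def FactRing_def A_RCOSETS_def' hc_class_def)

lemma one_hecke_clifford: "one (hecke_clifford d) = hc_class d 1"
  by (simp add: hecke_clifford_def Let_def FactRing_def hc_class_def)

lemma mult_hecke_clifford:
  "f \<in> carrier (free_alg d) \<Longrightarrow> h \<in> carrier (free_alg d) \<Longrightarrow>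
    mult (hecke_clifford d) (hc_class d f) (hc_class d h) = hc_class d (f * h)"
  using ideal.rcoset_mult_add[OF ideal_hc_ideal, of f d h]
  by (simp add: hecke_clifford_def Let_def FactRing_def hc_class_def)

lemma add_hecke_clifford:
  assumes "f \<in> carrier (free_alg d)" "h \<in> carrier (free_alg d)"
  shows "add (hecke_clifford d) (hc_class d f) (hc_class d h) = hc_class d (f + h)"
proof -
  interpret ideal "hc_ideal d" "free_alg d" by (rule ideal_hc_ideal)
  show ?thesis using a_rcos_sum[OF assms]
    by (simp add: hecke_clifford_def Let_def FactRing_def hc_class_def)
qed

lemma smult_hecke_clifford:
  "f \<in> carrier (free_alg d) \<Longrightarrow>
    smult (hecke_clifford d) c (hc_class d f) = hc_class d (Poly_Mapping.single 0 c * f)"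
  using mult_hecke_clifford[of "Poly_Mapping.single 0 c" d f] single_in_free_alg[of 0 d c]
  by (simp add: hecke_clifford_def Let_def zero_list_def)

lemma hc_class_eqD:
  assumes "hc_class d f = hc_class d h" "f \<in> carrier (free_alg d)"
  obtains k where "k \<in> hc_ideal d" "f = k + h"
proof -
  interpret ideal "hc_ideal d" "free_alg d" by (rule ideal_hc_ideal)
  have "f \<in> hc_class d h"
    using a_rcos_self[OF assms(2)] assms(1) by (simp add: hc_class_def)
  then show ?thesis using that by (auto simp: hc_class_def a_r_coset_def')
qed

text \<open>Every class is a linear combination of products of generators.\<close>

lemma superalg_hom_unique:
  assumes \<phi>: "superalg_hom (hecke_clifford d) G B H \<phi>" and \<psi>: "superalg_hom (hecke_clifford d) G B H \<psi>"
    and gens: "\<And>x. x \<in> hgens d \<Longrightarrow>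
      \<phi> (hc_class d (Poly_Mapping.single [x] 1)) = \<psi> (hc_class d (Poly_Mapping.single [x] 1))"
    and U: "U \<in> carrier (hecke_clifford d)"
  shows "\<phi> U = \<psi> U"
proof -
  note in_carrier = carrier_hecke_clifford imageI single_in_free_alg
  have word: "\<phi> (hc_class d (Poly_Mapping.single w 1)) = \<psi> (hc_class d (Poly_Mapping.single w 1))"
    if "set w \<subseteq> hgens d" for w
    using that
  proof (induction w)
    case Nil
    have "Poly_Mapping.single [] 1 = (1 :: free_elem)" by (simp flip: zero_list_def)
    then show ?case
      using \<phi> \<psi> by (simp add: superalg_hom_def ring_hom_def flip: one_hecke_clifford)
  next
    case (Cons x w)
    have "Poly_Mapping.single (x # w) 1 = Poly_Mapping.single [x] 1 * (Poly_Mapping.single w 1 :: free_elem)"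
      by (simp add: mult_single plus_list_def)
    then have "hc_class d (Poly_Mapping.single (x # w) 1) =
        mult (hecke_clifford d) (hc_class d (Poly_Mapping.single [x] 1)) (hc_class d (Poly_Mapping.single w 1))"
      using Cons.prems by (simp add: mult_hecke_clifford single_in_free_alg)
    then show ?case
      using Cons \<phi> \<psi> gens[of x] by (simp add: superalg_hom_def ring_hom_def in_carrier)
  qed
  have mono: "\<phi> (hc_class d (Poly_Mapping.single w c)) = \<psi> (hc_class d (Poly_Mapping.single w c))"
    if "set w \<subseteq> hgens d" for w c
  proof -
    have "hc_class d (Poly_Mapping.single w c) = smult (hecke_clifford d) c (hc_class d (Poly_Mapping.single w 1))"
      using that by (simp add: smult_hecke_clifford single_in_free_alg mult_single)
    then show ?thesis using \<phi> \<psi> word[OF that] that by (simp add: superalg_hom_def in_carrier)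
  qed
  obtain f where f: "f \<in> carrier (free_alg d)" and U: "U = hc_class d f"
    using U by (auto simp: carrier_hecke_clifford)
  show ?thesis unfolding U using f
  proof (induction rule: free_alg_induct)
    case zero
    show ?case using mono[of "[]" 0] by simp
  next
    case (add w c h)
    then show ?case
      using \<phi> \<psi> mono[of w c]
      by (simp add: add_hecke_clifford[symmetric] single_in_free_alg superalg_hom_def ring_hom_def carrier_hecke_clifford)
  qed
qed

section \<open>Evaluation of noncommutative polynomials\<close>

context q_tensor
begin

lemma K_simps: "K (b + c) = K b + K c" "K (b * c) = K b * K c" "K 0 = 0" "K 1 = 1" "K (- c) = - K c"
  by (rule add_endo_ext; simp add: apply_endo_K scale_left_distrib scale_minus_left)+

fun gen_op :: "hgen \<Rightarrow> 'm tensor add_endo" where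
  "gen_op (GenS i) = S i (i + 1)"
| "gen_op (GenX i) = X i"
| "gen_op (GenC i) = C i"

definition word_op :: "hgen list \<Rightarrow> 'm tensor add_endo" where
  "word_op w = prod_list (map gen_op w)"

definition evaluation :: "free_elem \<Rightarrow> 'm tensor add_endo" where
  "evaluation f = (\<Sum>w\<in>Poly_Mapping.keys f. K (Poly_Mapping.lookup f w) * word_op w)"

lemma word_op_simps: "word_op [] = 1" "word_op (v @ w) = word_op v * word_op w"
  by (simp_all add: word_op_def)

lemma K_gen_op: "gen_op x * K c = K c * gen_op x"
  using lin_op_S lin_op_X lin_op_C by (cases x) (auto simp: lin_op_def)

lemma K_word_op: "word_op w * K c = K c * word_op w"
proof (induction w)
  case (Cons x w)
  have "word_op (x # w) * K c = gen_op x * (word_op w * K c)"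
    by (simp add: word_op_def mult.assoc)
  also have "\<dots> = gen_op x * K c * word_op w"
    by (simp add: Cons.IH mult.assoc)
  also have "\<dots> = K c * word_op (x # w)"
    by (simp add: K_gen_op word_op_def mult.assoc)
  finally show ?case .
qed (simp add: word_op_def)

lemma evaluation_superset:
  assumes "finite A" "Poly_Mapping.keys f \<subseteq> A"
  shows "evaluation f = (\<Sum>w\<in>A. K (Poly_Mapping.lookup f w) * word_op w)"
  unfolding evaluation_def
  by (rule sum.mono_neutral_left) (use assms in \<open>auto simp: in_keys_iff K_simps\<close>)

lemma evaluation_add: "evaluation (f + h) = evaluation f + evaluation h"
proof -
  let ?A = "Poly_Mapping.keys f \<union> Poly_Mapping.keys h"
  have "evaluation (f + h) = (\<Sum>w\<in>?A. K (Poly_Mapping.lookup (f + h) w) * word_op w)"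
    by (rule evaluation_superset) (use Poly_Mapping.keys_add[of f h] in auto)
  also have "\<dots> = (\<Sum>w\<in>?A. K (Poly_Mapping.lookup f w) * word_op w) + (\<Sum>w\<in>?A. K (Poly_Mapping.lookup h w) * word_op w)"
    by (simp add: lookup_add K_simps distrib_right sum.distrib)
  also have "\<dots> = evaluation f + evaluation h"
    by (simp add: evaluation_superset[of ?A])
  finally show ?thesis .
qed

lemma evaluation_single: "evaluation (Poly_Mapping.single w c) = K c * word_op w"
  by (cases "c = 0") (simp_all add: evaluation_def K_simps)

lemma evaluation_zero: "evaluation 0 = 0"
  by (simp add: evaluation_def)

lemma evaluation_sum: "evaluation (sum f A) = (\<Sum>a\<in>A. evaluation (f a))"
  by (induction A rule: infinite_finite_induct) (simp_all add: evaluation_zero evaluation_add)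

lemma evaluation_mult: "evaluation (f * h) = evaluation f * evaluation h"
proof -
  have single: "evaluation (Poly_Mapping.single v b * Poly_Mapping.single w c) =
      evaluation (Poly_Mapping.single v b) * evaluation (Poly_Mapping.single w c)" for v w b c
  proof -
    have "evaluation (Poly_Mapping.single v b * Poly_Mapping.single w c) = K b * (K c * word_op v) * word_op w"
      by (simp add: mult_single evaluation_single plus_list_def word_op_simps K_simps mult.assoc)
    also have "\<dots> = K b * (word_op v * K c) * word_op w"
      by (simp only: K_word_op)
    finally show ?thesis by (simp add: evaluation_single mult.assoc)
  qed
  have "evaluation (f * h) = evaluation ((\<Sum>v\<in>Poly_Mapping.keys f. Poly_Mapping.single v (Poly_Mapping.lookup f v)) *
      (\<Sum>w\<in>Poly_Mapping.keys h. Poly_Mapping.single w (Poly_Mapping.lookup h w)))"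
    by (simp only: sum_single_keys)
  also have "\<dots> = (\<Sum>v\<in>Poly_Mapping.keys f. evaluation (Poly_Mapping.single v (Poly_Mapping.lookup f v))) *
      (\<Sum>w\<in>Poly_Mapping.keys h. evaluation (Poly_Mapping.single w (Poly_Mapping.lookup h w)))"
    by (simp only: sum_product evaluation_sum single)
  also have "\<dots> = evaluation f * evaluation h"
    by (simp only: evaluation_sum[symmetric] sum_single_keys)
  finally show ?thesis .
qed

lemma evaluation_one: "evaluation 1 = 1"
  using evaluation_single[of 0 1] by (simp add: zero_list_def[symmetric] K_simps) (simp add: zero_list_def word_op_simps)

lemma evaluation_uminus: "evaluation (- f) = - evaluation f"
  using evaluation_add[of f "- f"] by (simp add: evaluation_zero eq_neg_iff_add_eq_0 add.commute)

lemma evaluation_diff: "evaluation (f - h) = evaluation f - evaluation h"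
  using evaluation_add[of f "- h"] by (simp add: evaluation_uminus)

lemma evaluation_gens: "evaluation (fs i) = S i (i + 1)" "evaluation (fx i) = X i" "evaluation (fc i) = C i"
  by (simp_all add: fs_def fx_def fc_def evaluation_single word_op_def K_simps)

lemma q_op_gen_op: "x \<in> hgens d \<Longrightarrow> q_op (gen_parity x) (gen_op x)"
  using q_op_S q_op_X q_op_C by (auto simp: hgens_def)

lemma q_op_word_op: "set w \<subseteq> hgens d \<Longrightarrow> q_op (sum_list (map gen_parity w)) (word_op w)"
proof (induction w)
  case Nil
  then show ?case by (simp add: word_op_def q_op_one)
next
  case (Cons x w)
  then show ?case using q_op_mult[OF q_op_gen_op[of x]] by (simp add: word_op_def)
qed

lemma q_op_term: "set w \<subseteq> hgens d \<Longrightarrow> q_op (sum_list (map gen_parity w)) (K c * word_op w)"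
  using q_op_mult[OF q_op_K q_op_word_op] by simp

lemma q_op_evaluation: "f \<in> free_gr d p \<Longrightarrow> q_op p (evaluation f)"
  unfolding evaluation_def
proof (rule q_op_sum)
  fix w assume "f \<in> free_gr d p" "w \<in> Poly_Mapping.keys f"
  then have "set w \<subseteq> hgens d" "sum_list (map gen_parity w) = p"
    by (auto simp: free_gr_def carrier_free_alg)
  then show "q_op p (K (Poly_Mapping.lookup f w) * word_op w)" using q_op_term by blast
qed

text \<open>Separating words of even and odd length in the odd generators.\<close>

lemma evaluation_decompose:
  assumes "f \<in> carrier (free_alg d)"
  obtains U V where "q_op 0 U" "q_op 1 V" "evaluation f = U + V"
proof -
  let ?W = "\<lambda>p. {w \<in> Poly_Mapping.keys f. sum_list (map gen_parity w) = p}"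
  let ?u = "\<lambda>p. \<Sum>w\<in>?W p. K (Poly_Mapping.lookup f w) * word_op w"
  have "q_op p (?u p)" for p
  proof (rule q_op_sum)
    fix w assume "w \<in> ?W p"
    then have "set w \<subseteq> hgens d" "sum_list (map gen_parity w) = p"
      using assms by (auto simp: carrier_free_alg)
    then show "q_op p (K (Poly_Mapping.lookup f w) * word_op w)" using q_op_term by blast
  qed
  moreover have "evaluation f = ?u 0 + ?u 1"
  proof -
    have "Poly_Mapping.keys f = ?W 0 \<union> ?W 1" by (auto simp flip: bit_not_zero_iff)
    then have "evaluation f = (\<Sum>w\<in>?W 0 \<union> ?W 1. K (Poly_Mapping.lookup f w) * word_op w)"
      unfolding evaluation_def by (rule sum.cong) simp
    also have "\<dots> = ?u 0 + ?u 1" by (rule sum.union_disjoint) auto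
    finally show ?thesis .
  qed
  ultimately show ?thesis using that by blast
qed

lemma evaluation_tensors:
  assumes "f \<in> carrier (free_alg d)" "t \<in> tensors n d" shows "apply_endo (evaluation f) t \<in> tensors n d"
proof -
  obtain U V where "q_op 0 U" "q_op 1 V" "evaluation f = U + V" by (rule evaluation_decompose[OF assms(1)])
  then show ?thesis using assms(2) by (simp add: q_op_def lin_op_def tensors_add)
qed

lemma apply_endo_P_tensors: "t \<in> tensors n d \<Longrightarrow> apply_endo P t = t"
  by (rule ext) (simp add: apply_endo_P tensors_def)

text \<open>Relations with a constant term hold in the ring only with \<open>P\<close> in place of \<open>1\<close>; on tensors
  the two agree.\<close>

lemma evaluation_rels:
  assumes "r \<in> hc_rels d" "t \<in> tensors n d" shows "apply_endo (evaluation r) t = 0"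
proof -
  have X: "X i * X j - X j * X i = 0" if "i \<in> {1..d}" "j \<in> {1..d}" for i j
    using that X_X[of i j] by simp
  have S2: "S i (i + 1) * S i (i + 1) - 1 = P - 1" if "i \<in> {1..<d}" for i
    using S_square[of i "i + 1"] that by simp
  have SSS: "S i (i + 1) * S (i + 1) (i + 1 + 1) * S i (i + 1)
      - S (i + 1) (i + 1 + 1) * S i (i + 1) * S (i + 1) (i + 1 + 1) = 0"
    if "i \<in> {1..<d}" "i + 1 \<in> {1..<d}" for i
    using S_braid[of i "i + 1" "i + 1 + 1"] that by simp
  have SS: "S i (i + 1) * S j (j + 1) - S j (j + 1) * S i (i + 1) = 0"
    if "j \<noteq> i" "j \<noteq> i + 1" "i \<noteq> j + 1" for i j
    using supercommD[OF S_supercomm_S[of i j "j + 1" "i + 1"]] that by simp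
  have C2: "C i * C i - - 1 = 1 - P" if "i \<in> {1..d}" for i
    using C_square[OF that] by simp
  have CC: "C i * C j - - (C j * C i) = 0" if "i \<noteq> j" for i j
    using supercommD[OF C_supercomm_C[OF that]] by simp
  have SC: "S i (i + 1) * C i - C (i + 1) * S i (i + 1) = 0" "S i (i + 1) * C (i + 1) - C i * S i (i + 1) = 0" for i
    using S_C[of i "i + 1"] by simp_all
  have SC': "S i (i + 1) * C j - C j * S i (i + 1) = 0" if "j \<noteq> i" "j \<noteq> i + 1" for i j
    using supercommD[OF S_supercomm_C[of j i "i + 1"]] that by simp
  have CX: "C i * X i - - (X i * C i) = 0" if "i \<in> {1..d}" for i
    using C_X[of i] that by simp
  have CX': "C j * X i - X i * C j = 0" if "j \<noteq> i" for i j
    using supercommD[OF C_supercomm_X[OF that]] by simp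
  have SX: "S i (i + 1) * X i - (X (i + 1) * S i (i + 1) - 1 + C i * C (i + 1)) = 1 - P"
    if "i \<in> {1..<d}" for i
    using S_X[of i] that by simp
  have SX': "S i (i + 1) * X j - X j * S i (i + 1) = 0" if "i \<in> {1..<d}" "j \<noteq> i" "j \<noteq> i + 1" for i j
    using supercommD[OF S_supercomm_X[of i j]] that by simp
  have "evaluation r = 0 \<or> evaluation r = P - 1 \<or> evaluation r = 1 - P"
    using assms(1) unfolding hc_rels_def
    by (elim UnE CollectE exE conjE;
        simp only: evaluation_diff evaluation_mult evaluation_add evaluation_uminus evaluation_one evaluation_gens
          X S2 SSS SS C2 CC SC SC' CX CX' SX SX' not_False_eq_True simp_thms)
  then show ?thesis using apply_endo_P_tensors[OF assms(2)] by auto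
qed

text \<open>The polynomials that vanish on the tensor space form a two-sided ideal, because evaluations preserve
  that space.\<close>

lemma evaluation_ideal:
  assumes "f \<in> hc_ideal d" "t \<in> tensors n d" shows "apply_endo (evaluation f) t = 0"
proof -
  let ?Z = "{f \<in> carrier (free_alg d). \<forall>t\<in>tensors n d. apply_endo (evaluation f) t = 0}"
  interpret ring "free_alg d" by (rule ring_free_alg)
  have "ideal ?Z (free_alg d)"
  proof (rule idealI[OF ring_free_alg])
    show "subgroup ?Z (add_monoid (free_alg d))"
    proof (rule add.subgroupI)
      show "?Z \<noteq> {}" using zero_closed by (auto simp: evaluation_zero)
      fix f assume f: "f \<in> ?Z"
      have "- f \<in> carrier (free_alg d)" using f by (simp add: carrier_free_alg)
      then have "\<ominus>\<^bsub>free_alg d\<^esub> f = - f" using f by (intro minus_equality) auto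
      then show "\<ominus>\<^bsub>free_alg d\<^esub> f \<in> ?Z"
        using f by (simp add: evaluation_uminus carrier_free_alg)
    qed (auto simp: evaluation_add free_alg_closed)
  qed (auto simp: evaluation_mult free_alg_closed evaluation_tensors)
  moreover have "hc_rels d \<subseteq> ?Z" using hc_rels_subset evaluation_rels by auto
  ultimately have "hc_ideal d \<subseteq> ?Z" unfolding hc_ideal_def by (rule genideal_minimal)
  then show ?thesis using assms by auto
qed

definition phi :: "free_elem set \<Rightarrow> 'm tensor \<Rightarrow> 'm tensor" where
  "phi = (\<lambda>U\<in>carrier (hecke_clifford d).
     restrict (apply_endo (evaluation (SOME f. f \<in> carrier (free_alg d) \<and> hc_class d f = U))) (tensors n d))"

text \<open>The value of \<open>phi\<close> may be computed from any representative, because two of them differ by an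
  element of the ideal.\<close>

lemma phi_hc_class:
  assumes "f \<in> carrier (free_alg d)"
  shows "phi (hc_class d f) = restrict (apply_endo (evaluation f)) (tensors n d)"
proof -
  define h where "h = (SOME h. h \<in> carrier (free_alg d) \<and> hc_class d h = hc_class d f)"
  have h: "h \<in> carrier (free_alg d) \<and> hc_class d h = hc_class d f"
    unfolding h_def by (rule someI[of _ f]) (simp add: assms)
  then obtain k where k: "k \<in> hc_ideal d" "h = k + f" using hc_class_eqD by blast
  have "phi (hc_class d f) = restrict (apply_endo (evaluation h)) (tensors n d)"
    using assms by (simp add: phi_def carrier_hecke_clifford h_def)
  also have "\<dots> = restrict (apply_endo (evaluation f)) (tensors n d)"
    by (rule restrict_ext) (simp add: k(2) evaluation_add evaluation_ideal[OF k(1)])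
  finally show ?thesis .
qed

lemma phi_superalg_hom:
  "superalg_hom (hecke_clifford d) (hc_gr d) (q_end sc n M \<rho> d) (q_end_gr sc n M \<rho> d) phi"
  unfolding superalg_hom_def
proof (intro conjI allI ballI)
  show "phi \<in> ring_hom (hecke_clifford d) (q_end sc n M \<rho> d)"
  proof (rule ring_hom_memI)
    fix U assume "U \<in> carrier (hecke_clifford d)"
    then obtain f where f: "f \<in> carrier (free_alg d)" "U = hc_class d f"
      by (auto simp: carrier_hecke_clifford)
    obtain A B where AB: "q_op 0 A" "q_op 1 B" "evaluation f = A + B" by (rule evaluation_decompose[OF f(1)])
    have "phi U = (\<lambda>t\<in>tensors n d. (\<lambda>w. restrict (apply_endo A) (tensors n d) t w + restrict (apply_endo B) (tensors n d) t w))"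
      unfolding f(2) phi_hc_class[OF f(1)] AB(3) by (rule restrict_ext) (simp add: plus_fun_def)
    then show "phi U \<in> carrier (q_end sc n M \<rho> d)"
      using q_op_q_end_gr[OF AB(1)] q_op_q_end_gr[OF AB(2)]
      unfolding q_end_def partial_object.simps by (intro CollectI exI conjI)
  next
    fix U V assume "U \<in> carrier (hecke_clifford d)" "V \<in> carrier (hecke_clifford d)"
    then obtain f h where f: "f \<in> carrier (free_alg d)" "U = hc_class d f"
      and h: "h \<in> carrier (free_alg d)" "V = hc_class d h"
      by (auto simp: carrier_hecke_clifford)
    show "phi (U \<otimes>\<^bsub>hecke_clifford d\<^esub> V) = phi U \<otimes>\<^bsub>q_end sc n M \<rho> d\<^esub> phi V"
      unfolding f(2) h(2)
      by (simp add: mult_hecke_clifford f h phi_hc_class free_alg_closed q_end_def compose_def evaluation_mult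
          evaluation_tensors cong: restrict_cong)
    show "phi (U \<oplus>\<^bsub>hecke_clifford d\<^esub> V) = phi U \<oplus>\<^bsub>q_end sc n M \<rho> d\<^esub> phi V"
      unfolding f(2) h(2)
      by (simp add: add_hecke_clifford f h phi_hc_class free_alg_closed q_end_def evaluation_add plus_fun_def
          cong: restrict_cong)
  next
    show "phi \<one>\<^bsub>hecke_clifford d\<^esub> = \<one>\<^bsub>q_end sc n M \<rho> d\<^esub>"
      by (simp add: one_hecke_clifford phi_hc_class one_in_free_alg evaluation_one q_end_def cong: restrict_cong)
  qed
next
  fix c U assume "U \<in> carrier (hecke_clifford d)"
  then obtain f where f: "f \<in> carrier (free_alg d)" "U = hc_class d f"
    by (auto simp: carrier_hecke_clifford)
  have c: "Poly_Mapping.single 0 c \<in> carrier (free_alg d)"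
    by (rule single_in_free_alg) (simp add: zero_list_def)
  have "evaluation (Poly_Mapping.single 0 c * f) = K c * evaluation f"
    by (simp add: evaluation_mult evaluation_single) (simp add: zero_list_def word_op_simps)
  then have "apply_endo (evaluation (Poly_Mapping.single 0 c * f)) t = (\<lambda>w. sc c (apply_endo (evaluation f) t w))" for t
    by (intro ext) (simp add: apply_endo_K)
  then show "phi (c \<odot>\<^bsub>hecke_clifford d\<^esub> U) = c \<odot>\<^bsub>q_end sc n M \<rho> d\<^esub> phi U"
    unfolding f(2) using f(1) c
    by (simp add: smult_hecke_clifford phi_hc_class free_alg_closed q_end_def cong: restrict_cong)
next
  fix p
  show "phi ` hc_gr d p \<subseteq> q_end_gr sc n M \<rho> d p"
  proof
    fix G assume "G \<in> phi ` hc_gr d p"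
    then obtain f where f: "f \<in> free_gr d p" "G = phi (hc_class d f)" by (auto simp: hc_gr_def)
    then have "f \<in> carrier (free_alg d)" by (simp add: free_gr_def)
    then show "G \<in> q_end_gr sc n M \<rho> d p"
      unfolding f(2) using q_op_q_end_gr[OF q_op_evaluation[OF f(1)]] by (simp add: phi_hc_class)
  qed
qed

lemma phi_gens:
  "i \<in> {1..d} \<Longrightarrow> phi (hc_c d i) = restrict (C_op sc n M i) (tensors n d)"
  "i \<in> {1..<d} \<Longrightarrow> phi (hc_s d i) = restrict (S_op sc n M i (i + 1)) (tensors n d)"
  "i \<in> {1..d} \<Longrightarrow> phi (hc_x d i) = restrict (X_op sc n M \<rho> i) (tensors n d)"
proof -
  have mem: "fc i \<in> carrier (free_alg d)" "fx i \<in> carrier (free_alg d)" if "i \<in> {1..d}" for i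
    using that by (auto simp: fc_def fx_def hgens_def intro!: single_in_free_alg)
  have mem': "fs i \<in> carrier (free_alg d)" if "i \<in> {1..<d}" for i
    using that by (auto simp: fs_def hgens_def intro!: single_in_free_alg)
  show "phi (hc_c d i) = restrict (C_op sc n M i) (tensors n d)" if "i \<in> {1..d}"
    unfolding hc_c_def phi_hc_class[OF mem(1)[OF that]] evaluation_gens using that
    by (intro restrict_ext C_op_eq[symmetric])
  show "phi (hc_s d i) = restrict (S_op sc n M i (i + 1)) (tensors n d)" if "i \<in> {1..<d}"
    unfolding hc_s_def phi_hc_class[OF mem'[OF that]] evaluation_gens using that
    by (intro restrict_ext S_op_eq[symmetric]) auto
  show "phi (hc_x d i) = restrict (X_op sc n M \<rho> i) (tensors n d)" if "i \<in> {1..d}"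
    unfolding hc_x_def phi_hc_class[OF mem(2)[OF that]] evaluation_gens using that
    by (intro restrict_ext X_op_eq[symmetric])
qed

end

section \<open>Existence and uniqueness of the homomorphism\<close>

theorem theorem7p4p1:
  fixes n d :: nat
    and sc :: "complex \<Rightarrow> 'm::ab_group_add \<Rightarrow> 'm"
    and M :: "bit \<Rightarrow> 'm set"
    and \<rho> :: "mat \<Rightarrow> 'm \<Rightarrow> 'm"
  assumes "n \<ge> 1" and "d \<ge> 1"
    and "q_supermodule sc n M \<rho>"
  shows "\<exists>!\<phi>. \<phi> \<in> extensional (carrier (hecke_clifford d)) \<and>
    superalg_hom (hecke_clifford d) (hc_gr d) (q_end sc n M \<rho> d) (q_end_gr sc n M \<rho> d) \<phi> \<and>
    (\<forall>i\<in>{1..d}. \<phi> (hc_c d i) = restrict (C_op sc n M i) (tensors n d)) \<and>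
    (\<forall>i\<in>{1..<d}. \<phi> (hc_s d i) = restrict (S_op sc n M i (i + 1)) (tensors n d)) \<and>
    (\<forall>i\<in>{1..d}. \<phi> (hc_x d i) = restrict (X_op sc n M \<rho> i) (tensors n d))"
    (is "\<exists>!\<phi>. ?A \<phi>")
proof (rule ex1I)
  interpret q_supermodule sc n M \<rho> by (rule assms(3))
  interpret q_tensor sc n M \<rho> d ..
  show phi: "?A phi"
    using phi_superalg_hom phi_gens by (simp add: phi_def)
  fix \<psi> assume \<psi>: "?A \<psi>"
  show "\<psi> = phi"
  proof (rule extensionalityI)
    show "\<psi> \<in> extensional (carrier (hecke_clifford d))" "phi \<in> extensional (carrier (hecke_clifford d))"
      using \<psi> phi by blast+
    fix U assume U: "U \<in> carrier (hecke_clifford d)"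
    show "\<psi> U = phi U"
    proof (rule superalg_hom_unique[OF _ _ _ U])
      show "superalg_hom (hecke_clifford d) (hc_gr d) (q_end sc n M \<rho> d) (q_end_gr sc n M \<rho> d) \<psi>"
        "superalg_hom (hecke_clifford d) (hc_gr d) (q_end sc n M \<rho> d) (q_end_gr sc n M \<rho> d) phi"
        using \<psi> phi by blast+
      fix x assume "x \<in> hgens d"
      then show "\<psi> (hc_class d (Poly_Mapping.single [x] 1)) = phi (hc_class d (Poly_Mapping.single [x] 1))"
        using \<psi> phi_gens
        by (auto simp: hgens_def hc_c_def hc_s_def hc_x_def fc_def fs_def fx_def)
    qed
  qed
qed

end
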